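(* For every nontrivial knot type $[K]$, $\frac{2}{3}\,\mathrm{sb}[K]+\frac{1}{3}\le \mathrm{sps}[K]$.
   Context: For a conformation $K$ of a knot (an embedded closed curve in $\mathbb{R}^3$ in the knot type) and a direction $p\in S^2$, let $\mathrm{br}(K,p)$ be the number of local maxima of $K$ with respect to the height function in direction $p$, an extremum along an interval of constant height counting as one extremum. The superbridge index is $\mathrm{sb}[K]=\min_{K\in[K]}\max_{p\in S^2}\mathrm{br}(K,p)$. A spherical stick diagram of $[K]$ is a closed curve on the 2-sphere formed by finitely many arcs of great circles (not entire great circles) joined end to end, whose self-intersections are transverse double points away from the arc endpoints, with crossing information at each self-intersection, representing $[K]$. For nontrivial $[K]$, $\mathrm{sps}[K]$ is the minimum number of great circle arcs in such a diagram. *)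

theory Defs
  imports "HOL-Analysis.Analysis" "HOL-Library.Extended_Real"
begin

abbreviation S1 :: "complex set" where "S1 \<equiv> sphere 0 1"

definition knot :: "(complex \<Rightarrow> real^3) \<Rightarrow> bool" where
  "knot f \<longleftrightarrow> continuous_on S1 f \<and> inj_on f S1"

definition ambient_isotopic :: "(complex \<Rightarrow> real^3) \<Rightarrow> (complex \<Rightarrow> real^3) \<Rightarrow> bool" where
  "ambient_isotopic f g \<longleftrightarrow>
     (\<exists>H :: real \<Rightarrow> real^3 \<Rightarrow> real^3.
        continuous_on ({0..1} \<times> UNIV) (\<lambda>(t, x). H t x) \<and>
        (\<forall>t\<in>{0..1}. \<exists>G. homeomorphism UNIV UNIV (H t) G) \<and>
        H 0 = id \<and> H 1 ` (f ` S1) = g ` S1)"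

definition knot_type :: "(complex \<Rightarrow> real^3) \<Rightarrow> (complex \<Rightarrow> real^3) set" where
  "knot_type K = {f. knot f \<and> ambient_isotopic K f}"

definition polygonal :: "(complex \<Rightarrow> real^3) \<Rightarrow> bool" where
  "polygonal g \<longleftrightarrow> (\<exists>S. finite S \<and> g ` S1 = (\<Union>(a, b)\<in>S. closed_segment a b))"

definition tame :: "(complex \<Rightarrow> real^3) \<Rightarrow> bool" where
  "tame K \<longleftrightarrow> (\<exists>g. knot g \<and> polygonal g \<and> ambient_isotopic K g)"

definition round_unknot :: "complex \<Rightarrow> real^3" where
  "round_unknot z = vector [Re z, Im z, 0]"

definition nontrivial :: "(complex \<Rightarrow> real^3) \<Rightarrow> bool" where
  "nontrivial K \<longleftrightarrow> \<not> ambient_isotopic K round_unknot"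

definition local_max_set :: "(complex \<Rightarrow> real^3) \<Rightarrow> real^3 \<Rightarrow> complex set \<Rightarrow> bool" where
  "local_max_set f p J \<longleftrightarrow>
     J \<subseteq> S1 \<and> J \<noteq> {} \<and> connected J \<and> closed J \<and>
     (\<exists>c. (\<forall>z\<in>J. f z \<bullet> p = c) \<and>
          (\<exists>U. open U \<and> J \<subseteq> U \<and> (\<forall>z\<in>(U \<inter> S1) - J. f z \<bullet> p < c)))"

definition enat_card :: "'a set \<Rightarrow> enat" where
  "enat_card A = (if finite A then enat (card A) else \<infinity>)"

definition br :: "(complex \<Rightarrow> real^3) \<Rightarrow> real^3 \<Rightarrow> enat" where
  "br f p = enat_card {J. local_max_set f p J}"

definition superbridge :: "(complex \<Rightarrow> real^3) \<Rightarrow> enat" where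
  "superbridge K = (INF f\<in>knot_type K. SUP p\<in>sphere (0::real^3) 1. br f p)"

text \<open>A spherical stick curve with n great circle arcs, parametrised on [0,1] with
  breakpoints t 0 = 0 < t 1 < ... < t n = 1; each piece is an injective arc of a
  great circle; self-intersections are transverse double points away from arc endpoints.\<close>
definition arc_piece :: "(real \<Rightarrow> real^3) \<Rightarrow> (nat \<Rightarrow> real) \<Rightarrow> nat \<Rightarrow> (real^3) set" where
  "arc_piece \<gamma> t i = \<gamma> ` {t i..t (Suc i)}"

definition spherical_stick_curve :: "nat \<Rightarrow> (real \<Rightarrow> real^3) \<Rightarrow> (nat \<Rightarrow> real) \<Rightarrow> bool" where
  "spherical_stick_curve n \<gamma> t \<longleftrightarrow>
     n \<ge> 1 \<and> t 0 = 0 \<and> t n = 1 \<and> (\<forall>i<n. t i < t (Suc i)) \<and>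
     continuous_on {0..1} \<gamma> \<and> \<gamma> 0 = \<gamma> 1 \<and>
     (\<forall>s\<in>{0..1}. \<gamma> s \<in> sphere 0 1) \<and>
     (\<forall>i<n. inj_on \<gamma> {t i..t (Suc i)} \<and>
            (\<exists>u::real^3. u \<noteq> 0 \<and> (\<forall>x\<in>arc_piece \<gamma> t i. x \<bullet> u = 0))) \<and>
     (\<forall>s\<in>{0..<1}. \<forall>s'\<in>{0..<1}. s \<noteq> s' \<and> \<gamma> s = \<gamma> s' \<longrightarrow>
        (\<forall>i\<le>n. s \<noteq> t i \<and> s' \<noteq> t i) \<and>
        (\<forall>s''\<in>{0..<1}. \<gamma> s'' = \<gamma> s \<longrightarrow> s'' = s \<or> s'' = s') \<and>
        (\<forall>i<n. \<forall>j<n. s \<in> {t i..t (Suc i)} \<and> s' \<in> {t j..t (Suc j)} \<longrightarrow>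
            span (arc_piece \<gamma> t i) \<noteq> span (arc_piece \<gamma> t j)))"

text \<open>A spherical stick diagram with crossing information representing the knot type of K:
  the crossing information is realised by a knot in the knot type of K whose radial
  projection to S^2 is the stick curve (the over-strand is the one with larger radius).\<close>
definition represents_sps :: "nat \<Rightarrow> (complex \<Rightarrow> real^3) \<Rightarrow> bool" where
  "represents_sps n K \<longleftrightarrow>
     (\<exists>\<gamma> t r f. spherical_stick_curve n \<gamma> t \<and> f \<in> knot_type K \<and>
        (\<forall>s\<in>{0..1}. r s > (0::real) \<and> f (cis (2 * pi * s)) = r s *\<^sub>R \<gamma> s))"

definition sps :: "(complex \<Rightarrow> real^3) \<Rightarrow> enat" where
  "sps K = (INF n\<in>{n. represents_sps n K}. enat n)"

end

theory Submission
  imports Defs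
begin

text \<open>Moving a knot radially, compatibly with the order of the strands at the crossings of its projection to the
  sphere, does not change its type. So the diagram can be realised on a quadric
  \<open>r = 1 / (1 + b \<bullet> \<omega>)\<close> with focus at the origin, up to an arbitrarily small smooth radial perturbation that
  creates the crossings. Each great circle arc then becomes a nearly conic planar arc with focus at the origin, whose
  tangent turns monotonically by less than \<open>2 pi\<close>, so every height function splits it into at most three monotone
  pieces. If \<open>b\<close> is almost a unit vector opposite to a direction missed by the first arc in its plane, that arc
  lies on a conic close to a parabola and turns by less than \<open>pi\<close>, which leaves only two pieces. A height function
  with at most \<open>3 n - 1\<close> monotone pieces has at most \<open>(3 n - 1) / 2\<close> local maxima.\<close>

section \<open>Radial isotopies\<close>

text \<open>The given representative is merely continuous, so \<open>ln r\<close> along an arc has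
  no derivative to argue with. On each ray a radial map acts on the logarithm of the radius by an
  affine map \<open>x \<mapsto> \<delta> * x + C \<omega>\<close>: the slope \<delta> > 0 keeps the
  order of the strands, and the shift, a function of the direction alone, acts alike on both strands
  of a crossing. A small \<delta> flattens the knot towards the quadric. The shift also carries a
  correction, continuous on the sphere, that turns \<open>ln r\<close> on each arc into a polynomial
  in the polar angle; it is single-valued because \<open>ln r\<close> is left unchanged at points
  shared by arcs. Only then are heights along an arc differentiable in the angle, and the convexity
  of conics survives the perturbation for small \<delta>. Saving one monotone piece is what produces
  the summand 1/3: three pieces on every arc would give only 2 sb \<le> 3 n. A single
  \<open>b\<close> has to serve all arcs, so the saving is arranged for one arc only.\<close>

lemma ambient_isotopic_trans:
  assumes "ambient_isotopic f g" "ambient_isotopic g h"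
  shows "ambient_isotopic f h"
proof -
  obtain H :: "real \<Rightarrow> real^3 \<Rightarrow> real^3"
    where H: "continuous_on ({0..1} \<times> UNIV) (\<lambda>(t, x). H t x)"
      "\<forall>t\<in>{0..1}. \<exists>G. homeomorphism UNIV UNIV (H t) G" "H 0 = id" "H 1 ` (f ` S1) = g ` S1"
    using assms(1) unfolding ambient_isotopic_def by blast
  obtain H' :: "real \<Rightarrow> real^3 \<Rightarrow> real^3"
    where H': "continuous_on ({0..1} \<times> UNIV) (\<lambda>(t, x). H' t x)"
      "\<forall>t\<in>{0..1}. \<exists>G. homeomorphism UNIV UNIV (H' t) G" "H' 0 = id" "H' 1 ` (g ` S1) = h ` S1"
    using assms(2) unfolding ambient_isotopic_def by blast
  \<comment> \<open>The clamps run the two isotopies one after the other: up to time 1/2 the outer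
    factor rests at \<open>H' 0 = id\<close>, afterwards the inner one rests at \<open>H 1\<close>.
    Continuity thus needs no gluing at 1/2.\<close>
  define L where "L = (\<lambda>t. H' (max 0 (2 * t - 1)) \<circ> H (min 1 (2 * t)))"
  have "continuous_on ({0..1} \<times> UNIV) (\<lambda>z. (\<lambda>(t, x). H t x) (min 1 (2 * fst z), snd z))"
    by (rule continuous_on_compose2[OF H(1)]) (auto intro!: continuous_intros)
  then have c: "continuous_on ({0..1} \<times> UNIV) (\<lambda>z. H (min 1 (2 * fst z)) (snd z))" by simp
  have "continuous_on ({0..1} \<times> UNIV)
     (\<lambda>z. (\<lambda>(t, x). H' t x) (max 0 (2 * fst z - 1), H (min 1 (2 * fst z)) (snd z)))"
    by (rule continuous_on_compose2[OF H'(1)]) (auto intro!: continuous_intros c)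
  then have 1: "continuous_on ({0..1} \<times> UNIV) (\<lambda>(t, x). L t x)"
    by (simp add: L_def case_prod_unfold)
  have 2: "\<exists>G. homeomorphism UNIV UNIV (L t) G" if "t \<in> {0..1}" for t
  proof -
    have "min 1 (2 * t) \<in> {0..1}" "max 0 (2 * t - 1) \<in> {0..1}" using that by auto
    then show ?thesis unfolding L_def using H(2) H'(2) homeomorphism_compose by metis
  qed
  have 3: "L 0 = id" using H(3) H'(3) by (simp add: L_def)
  have 4: "L 1 ` (f ` S1) = h ` S1"
    using H(4) H'(4) image_comp[of "H' 1" "H 1" "f ` S1"] by (simp add: L_def)
  show ?thesis unfolding ambient_isotopic_def using 1 2 3 4 by blast
qed

text \<open>With the logarithm of the norm as coordinate on the ray through \<omega>, this is the
  affine map with slope \<open>l\<close> and shift \<open>c \<omega>\<close>. That explains the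
  inverse, with slope \<open>1 / l\<close> and shift \<open>- c \<omega> / l\<close>, and the linear
  interpolation to the identity. The origin is fixed because \<open>sgn 0 = 0\<close>.\<close>

definition radial_map :: "real \<Rightarrow> ('a \<Rightarrow> real) \<Rightarrow> 'a::euclidean_space \<Rightarrow> 'a" where
  "radial_map l c x = (norm x powr l * exp (c (sgn x))) *\<^sub>R sgn x"

lemma norm_radial_map: "norm (radial_map l c x) = norm x powr l * exp (c (sgn x))"
  by (cases "x = 0") (auto simp: radial_map_def norm_sgn)

lemma sgn_radial_map: "sgn (radial_map l c x) = sgn x"
proof (cases "x = 0")
  case False
  then have "sgn (norm x powr l * exp (c (sgn x))) = 1" by (simp add: sgn_1_pos)
  moreover have "sgn (sgn x) = sgn x" using False by (simp add: sgn_div_norm)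
  ultimately show ?thesis by (simp add: radial_map_def sgn_scaleR)
qed (simp add: radial_map_def)

lemma radial_map_inverse:
  assumes "l \<noteq> 0"
  shows "radial_map (1 / l) (\<lambda>\<omega>. - c \<omega> / l) (radial_map l c x) = x"
proof (cases "x = 0")
  case False
  then have "(norm x powr l * exp (c (sgn x))) powr (1 / l) * exp (- c (sgn x) / l) = norm x"
    using assms by (simp add: powr_mult powr_powr exp_powr_real flip: exp_add)
  then show ?thesis
    unfolding radial_map_def[of "1 / l"] sgn_radial_map norm_radial_map using False by (simp add: sgn_div_norm)
qed (simp add: radial_map_def)

lemma radial_map_inverse':
  assumes "l \<noteq> 0"
  shows "radial_map l c (radial_map (1 / l) (\<lambda>\<omega>. - c \<omega> / l) x) = x"
  using radial_map_inverse[of "1 / l" "\<lambda>\<omega>. - c \<omega> / l" x] assms by simp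

text \<open>The delicate point is the origin, where \<open>c (sgn x)\<close> need not have a limit.
  Compactness of the sphere bounds \<open>c\<close> by some \<open>B\<close>, and the uniform lower
  bound \<open>m > 0\<close> on the exponents then dominates the norm by
  \<open>norm x powr m * exp (A * B)\<close> near 0, uniformly in the parameter.\<close>

lemma continuous_on_radial_map:
  fixes c :: "'a::euclidean_space \<Rightarrow> real" and l a :: "'b::topological_space \<Rightarrow> real"
  assumes c: "continuous_on (sphere 0 1) c"
    and l: "continuous_on T l" "\<And>t. t \<in> T \<Longrightarrow> m \<le> l t" "0 < m"
    and a: "continuous_on T a" "\<And>t. t \<in> T \<Longrightarrow> \<bar>a t\<bar> \<le> A"
  shows "continuous_on (T \<times> UNIV) (\<lambda>(t, x). radial_map (l t) (\<lambda>\<omega>. a t * c \<omega>) x)"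
proof -
  obtain B where B: "\<And>\<omega>. norm \<omega> = 1 \<Longrightarrow> \<bar>c \<omega>\<bar> \<le> B" 
    using compact_continuous_image[OF c compact_sphere, THEN compact_imp_bounded]
    unfolding bounded_iff by force
  have B0: "0 \<le> B"
  proof -
    obtain b :: 'a where "b \<in> Basis" using nonempty_Basis by blast
    then show ?thesis using B[of b] by simp
  qed
  let ?F = "\<lambda>z. radial_map (l (fst z)) (\<lambda>\<omega>. a (fst z) * c \<omega>) (snd z)"
  have "continuous_on (T \<times> - {0}) (\<lambda>z::'b \<times> 'a. sgn (snd z))"
    unfolding sgn_div_norm by (intro continuous_intros) auto
  then have "continuous_on (T \<times> - {0}) (\<lambda>z. c (sgn (snd z)))"
    by (rule continuous_on_compose2[OF c]) (auto simp: norm_sgn split: if_splits)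
  then have away: "continuous_on (T \<times> - {0}) ?F"
    unfolding radial_map_def sgn_div_norm
    by (intro continuous_intros continuous_on_compose2[OF l(1)] continuous_on_compose2[OF a(1)])
       (auto simp: sgn_div_norm)
  have "(?F \<longlongrightarrow> ?F z) (at z within T \<times> UNIV)" if z: "z \<in> T \<times> UNIV" for z
  proof (cases "snd z = 0")
    case False
    then have "(?F \<longlongrightarrow> ?F z) (at z within T \<times> - {0})"
      using away[unfolded continuous_on_def, THEN bspec, of z] z by (simp add: mem_Times_iff)
    moreover have "at z within T \<times> - {0} = at z within T \<times> UNIV"
    proof (rule at_within_nhd[of z "UNIV \<times> - {0}"])
      show "open (UNIV \<times> - {0 :: 'a})" for z :: 'b by (intro open_Times) auto
    qed (use False in \<open>auto simp: mem_Times_iff\<close>)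
    ultimately show ?thesis by simp
  next
    case True
    have "(?F \<longlongrightarrow> 0) (at z within T \<times> UNIV)"
    proof (rule Lim_null_comparison)
      have "((\<lambda>w. norm (snd w)) \<longlongrightarrow> norm (snd z)) (at z within T \<times> UNIV)"
        by (intro tendsto_intros)
      then have n0: "((\<lambda>w. norm (snd w)) \<longlongrightarrow> 0) (at z within T \<times> UNIV)" using True by simp
      have "\<forall>\<^sub>F w in at z within T \<times> UNIV. norm (snd w) < 1"
        using order_tendstoD(2)[OF n0, of 1] by simp
      moreover have "\<forall>\<^sub>F w in at z within T \<times> UNIV. w \<in> T \<times> UNIV"
        by (simp add: eventually_at_filter)
      ultimately show "\<forall>\<^sub>F w in at z within T \<times> UNIV. norm (?F w) \<le> norm (snd w) powr m * exp (A * B)"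
      proof eventually_elim
        case (elim w)
        show ?case
        proof (cases "snd w = 0")
          case False
          have "norm (snd w) powr l (fst w) \<le> norm (snd w) powr m"
            using elim l(2)[of "fst w"] False by (intro powr_mono') (auto simp: mem_Times_iff)
          moreover have "a (fst w) * c (sgn (snd w)) \<le> \<bar>a (fst w)\<bar> * \<bar>c (sgn (snd w))\<bar>"
            by (metis abs_ge_self abs_mult)
          moreover have "\<bar>a (fst w)\<bar> * \<bar>c (sgn (snd w))\<bar> \<le> A * B"
            using a(2)[of "fst w"] B[of "sgn (snd w)"] elim False
            by (intro mult_mono) (auto simp: norm_sgn mem_Times_iff)
          ultimately show ?thesis unfolding norm_radial_map by (intro mult_mono) auto
        qed (simp add: radial_map_def)
      qed
      have "((\<lambda>w. norm (snd w) powr m) \<longlongrightarrow> 0 powr m) (at z within T \<times> UNIV)"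
        using n0 l(3) by (intro tendsto_powr2) auto
      then show "((\<lambda>w. norm (snd w) powr m * exp (A * B)) \<longlongrightarrow> 0) (at z within T \<times> UNIV)"
        by (simp add: tendsto_mult_left_zero)
    qed
    then show ?thesis using True by (simp add: radial_map_def)
  qed
  then show ?thesis by (simp add: continuous_on_def case_prod_unfold)
qed

lemma continuous_radial_map:
  assumes "continuous_on (sphere 0 1) c" "0 < l"
  shows "continuous_on UNIV (radial_map l c)"
proof -
  have "continuous_on ({0::real} \<times> UNIV) (\<lambda>(t, x). radial_map l (\<lambda>\<omega>. 1 * c \<omega>) x)"
    by (rule continuous_on_radial_map[OF assms(1), where m = l and A = 1]) (use assms in auto)
  then have "continuous_on UNIV (\<lambda>x. (\<lambda>(t, x). radial_map l (\<lambda>\<omega>. 1 * c \<omega>) x) (0::real, x))"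
    by (rule continuous_on_compose2) (auto intro!: continuous_intros)
  then show ?thesis by (simp add: fun_eq_iff)
qed

lemma homeomorphism_radial_map:
  assumes "continuous_on (sphere 0 1) c" "0 < l"
  shows "homeomorphism UNIV UNIV (radial_map l c) (radial_map (1 / l) (\<lambda>\<omega>. - c \<omega> / l))"
proof (rule homeomorphismI)
  show "continuous_on UNIV (radial_map (1 / l) (\<lambda>\<omega>. - c \<omega> / l))"
    using assms by (intro continuous_radial_map continuous_intros) auto
  show "radial_map (1 / l) (\<lambda>\<omega>. - c \<omega> / l) (radial_map l c x) = x" for x
    using assms by (intro radial_map_inverse) auto
  show "radial_map l c (radial_map (1 / l) (\<lambda>\<omega>. - c \<omega> / l) y) = y" for y
    using assms by (intro radial_map_inverse') auto
qed (use assms continuous_radial_map in auto)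

text \<open>Interpolating the exponent and the logarithmic factor linearly deforms a radial map to the identity
  through radial maps.\<close>
lemma radial_map_in_knot_type:
  assumes f: "f \<in> knot_type K" and c: "continuous_on (sphere 0 1) c" and d: "0 < d"
  shows "radial_map d c \<circ> f \<in> knot_type K"
proof -
  define H where "H = (\<lambda>t::real. radial_map (1 - t + t * d) (\<lambda>\<omega>. t * c \<omega>))"
  \<comment> \<open>A convex combination of 1 and \<open>d\<close> is at least their minimum, which
    supplies the uniform positive exponent needed for joint continuity at the origin.\<close>
  have pos: "min 1 d \<le> 1 - t + t * d" if "0 \<le> t" "t \<le> 1" for t
  proof -
    have "min 1 d * (1 - t) + min 1 d * t \<le> 1 * (1 - t) + d * t"
      using that by (intro add_mono mult_right_mono) auto
    then show ?thesis by (simp add: algebra_simps)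
  qed
  have "continuous_on ({0..1} \<times> UNIV) (\<lambda>(t, x). H t x)"
    unfolding H_def
    by (rule continuous_on_radial_map[OF c, where m = "min 1 d" and A = 1])
       (use pos d in \<open>auto intro!: continuous_intros\<close>)
  moreover have "\<exists>G. homeomorphism UNIV UNIV (H t) G" if "t \<in> {0..1}" for t
  proof -
    have "0 < 1 - t + t * d" using pos[of t] that d by auto
    moreover have "continuous_on (sphere 0 1) (\<lambda>\<omega>. t * c \<omega>)" using c by (intro continuous_intros)
    ultimately show ?thesis unfolding H_def using homeomorphism_radial_map by blast
  qed
  moreover have "H 0 = id"
  proof
    fix x show "H 0 x = id x" by (cases "x = 0") (simp_all add: H_def radial_map_def sgn_div_norm)
  qed
  moreover have "H 1 = radial_map d c" by (simp add: H_def)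
  ultimately have "ambient_isotopic f (radial_map d c \<circ> f)"
    unfolding ambient_isotopic_def by (intro exI[of _ H]) (auto simp: image_comp)
  moreover have "inj (radial_map d c)"
    by (rule inj_on_inverseI[of _ "radial_map (1 / d) (\<lambda>\<omega>. - c \<omega> / d)"]) (rule radial_map_inverse, use d in simp)
  then have "knot (radial_map d c \<circ> f)"
    using f continuous_on_compose2[OF continuous_radial_map[OF c d]] unfolding knot_type_def knot_def comp_def
    by (auto simp: inj_on_def)
  ultimately show ?thesis
    using f ambient_isotopic_trans unfolding knot_type_def by blast
qed

section \<open>Heights on perturbed conics\<close>

lemma sin_sign_between_multiples_pi:
  fixes j :: int
  shows "(\<forall>t\<in>{of_int j * pi..of_int (j + 1) * pi}. 0 \<le> sin t) \<or>
         (\<forall>t\<in>{of_int j * pi..of_int (j + 1) * pi}. sin t \<le> 0)"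
proof -
  have eq: "sin t = (if even j then 1 else -1) * sin (t - of_int j * pi)" for t
    using sin_add[of "t - of_int j * pi" "of_int j * pi"] sin_npi_int[of j] cos_npi_int[of j]
    by (simp add: mult.commute[of pi])
  have nn: "0 \<le> sin (t - of_int j * pi)" if "t \<in> {of_int j * pi..of_int (j + 1) * pi}" for t
    using that by (intro sin_ge_zero) (auto simp: algebra_simps)
  show ?thesis
  proof (cases "even j")
    case True
    then show ?thesis using nn eq by (metis mult_1)
  next
    case False
    then have "sin t \<le> 0" if "t \<in> {of_int j * pi..of_int (j + 1) * pi}" for t
      using nn[OF that] eq[of t] by simp
    then show ?thesis by blast
  qed
qed

lemma sine_derivative_monotone:
  fixes j :: int
  assumes der: "\<And>x. x \<in> {p..q} \<Longrightarrow> (F has_real_derivative - (M x * sin (\<psi> x - \<phi>))) (at x)"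
    and M: "\<And>x. x \<in> {p..q} \<Longrightarrow> 0 \<le> M x"
    and rng: "\<And>x. x \<in> {p..q} \<Longrightarrow> \<phi> + of_int j * pi \<le> \<psi> x \<and> \<psi> x \<le> \<phi> + of_int (j + 1) * pi"
  shows "mono_on {p..q} F \<or> antimono_on {p..q} F"
proof -
  have r: "\<psi> x - \<phi> \<in> {of_int j * pi..of_int (j + 1) * pi}" if "x \<in> {p..q}" for x
    using rng[OF that] by auto
  consider "\<forall>x\<in>{p..q}. 0 \<le> sin (\<psi> x - \<phi>)" | "\<forall>x\<in>{p..q}. sin (\<psi> x - \<phi>) \<le> 0"
    using sin_sign_between_multiples_pi[of j] r by blast
  then show ?thesis
  proof cases
    case 1
    have "F y \<le> F x" if "x \<in> {p..q}" "y \<in> {p..q}" "x \<le> y" for x y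
    proof (rule DERIV_nonpos_imp_nonincreasing[OF that(3)])
      fix z assume "x \<le> z" "z \<le> y"
      then have z: "z \<in> {p..q}" using that by auto
      show "\<exists>d. (F has_real_derivative d) (at z) \<and> d \<le> 0"
        using der[OF z] M[OF z] 1 z by (intro exI[of _ "- (M z * sin (\<psi> z - \<phi>))"] conjI) auto
    qed
    then show ?thesis by (auto simp: monotone_on_def)
  next
    case 2
    have "F x \<le> F y" if "x \<in> {p..q}" "y \<in> {p..q}" "x \<le> y" for x y
    proof (rule DERIV_nonneg_imp_nondecreasing[OF that(3)])
      fix z assume "x \<le> z" "z \<le> y"
      then have z: "z \<in> {p..q}" using that by auto
      show "\<exists>d. (F has_real_derivative d) (at z) \<and> 0 \<le> d"
        using der[OF z] M[OF z] 2 z by (intro exI[of _ "- (M z * sin (\<psi> z - \<phi>))"] conjI) (auto simp: mult_nonneg_nonpos)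
    qed
    then show ?thesis by (auto simp: monotone_on_def)
  qed
qed

text \<open>The derivative can change sign only where the phase \<psi> passes \<phi> plus a multiple
  of \<pi>. An increasing phase with range at most 2 \<pi> is cut by two consecutive such levels
  into three stretches, each between neighbouring multiples; with range at most \<pi> the last
  stretch shrinks to a point.\<close>

lemma sine_derivative_pieces:
  fixes F M \<psi> :: "real \<Rightarrow> real"
  assumes ab: "\<alpha> \<le> \<omega>" and cont: "continuous_on {\<alpha>..\<omega>} \<psi>" and sm: "strict_mono_on {\<alpha>..\<omega>} \<psi>"
    and rng: "\<psi> \<omega> - \<psi> \<alpha> \<le> 2 * pi"
    and der: "\<And>x. x \<in> {\<alpha>..\<omega>} \<Longrightarrow> (F has_real_derivative - (M x * sin (\<psi> x - \<phi>))) (at x)"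
    and M: "\<And>x. x \<in> {\<alpha>..\<omega>} \<Longrightarrow> 0 \<le> M x"
  obtains x1 x2 where "\<alpha> \<le> x1" "x1 \<le> x2" "x2 \<le> \<omega>" "\<psi> \<omega> - \<psi> \<alpha> \<le> pi \<Longrightarrow> x2 = \<omega>"
    "mono_on {\<alpha>..x1} F \<or> antimono_on {\<alpha>..x1} F"
    "mono_on {x1..x2} F \<or> antimono_on {x1..x2} F"
    "mono_on {x2..\<omega>} F \<or> antimono_on {x2..\<omega>} F"
proof -
  have mono: "\<psi> x \<le> \<psi> y" if "x \<in> {\<alpha>..\<omega>}" "y \<in> {\<alpha>..\<omega>}" "x \<le> y" for x y
    using strict_mono_on_leD[OF sm] that by blast
  have less: "x < y" if "x \<in> {\<alpha>..\<omega>}" "y \<in> {\<alpha>..\<omega>}" "\<psi> x < \<psi> y" for x y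
    using mono[OF that(2,1)] that(3) by linarith
  have inj: "x = y" if "x \<in> {\<alpha>..\<omega>}" "y \<in> {\<alpha>..\<omega>}" "\<psi> x = \<psi> y" for x y
    using strict_mono_onD[OF sm, of x y] strict_mono_onD[OF sm, of y x] that by fastforce
  define k where "k = \<lceil>(\<psi> \<alpha> - \<phi>) / pi\<rceil>"
  have "(\<psi> \<alpha> - \<phi>) / pi \<le> of_int k" "of_int k - 1 < (\<psi> \<alpha> - \<phi>) / pi" unfolding k_def by linarith+
  then have k: "\<psi> \<alpha> \<le> \<phi> + of_int k * pi" "\<phi> + of_int (k - 1) * pi \<le> \<psi> \<alpha>"
    by (simp_all add: field_simps)
  \<comment> \<open>The first level not below \<open>\<psi> \<alpha>\<close>, and the next one.
    Capping them at \<open>\<psi> \<omega>\<close> turns levels that are never reached into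
    degenerate pieces at the right end, so there are always exactly three pieces.\<close>
  define z1 z2 where "z1 = min (\<phi> + of_int k * pi) (\<psi> \<omega>)" and "z2 = min (\<phi> + of_int (k + 1) * pi) (\<psi> \<omega>)"
  have le: "\<psi> \<alpha> \<le> \<psi> \<omega>" using mono ab by auto
  have pi: "(of_int (k + 1) :: real) * pi = of_int k * pi + pi" "(of_int (k + 2) :: real) * pi = of_int k * pi + 2 * pi"
    by (simp_all add: algebra_simps)
  have z: "\<psi> \<alpha> \<le> z1" "z1 \<le> z2" "z2 \<le> \<psi> \<omega>"
    using le k(1) pi pi_gt_zero unfolding z1_def z2_def min_def by (smt (verit))+
  obtain x1 where x1: "x1 \<in> {\<alpha>..\<omega>}" "\<psi> x1 = z1" using IVT'[of \<psi> \<alpha> z1 \<omega>] z ab cont by auto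
  obtain x2 where x2: "x2 \<in> {\<alpha>..\<omega>}" "\<psi> x2 = z2" using IVT'[of \<psi> \<alpha> z2 \<omega>] z ab cont by auto
  have 12: "x1 \<le> x2" using inj[of x1 x2] less[of x1 x2] x1 x2 z(2) by fastforce
  have end2: "x2 = \<omega>" if "\<psi> \<omega> \<le> \<phi> + of_int (k + 1) * pi"
    using inj[of x2 \<omega>] x2 that ab by (auto simp: z2_def)
  have triv: "mono_on {x..x} F" for x by (auto simp: monotone_on_def)
  show ?thesis
  proof (rule that[of x1 x2])
    show "\<alpha> \<le> x1" "x1 \<le> x2" "x2 \<le> \<omega>" using x1 x2 12 by auto
    show "x2 = \<omega>" if "\<psi> \<omega> - \<psi> \<alpha> \<le> pi"
    proof (rule end2)
      show "\<psi> \<omega> \<le> \<phi> + of_int (k + 1) * pi" using that k(1) unfolding pi(1) by linarith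
    qed
    show "mono_on {\<alpha>..x1} F \<or> antimono_on {\<alpha>..x1} F"
    proof (rule sine_derivative_monotone[where j = "k - 1" and M = M and \<psi> = \<psi> and \<phi> = \<phi>])
      fix x assume x: "x \<in> {\<alpha>..x1}"
      then have "\<psi> \<alpha> \<le> \<psi> x" "\<psi> x \<le> z1" using mono[of \<alpha> x] mono[of x x1] x1 by auto
      then show "\<phi> + of_int (k - 1) * pi \<le> \<psi> x \<and> \<psi> x \<le> \<phi> + of_int (k - 1 + 1) * pi"
        using k by (auto simp: z1_def)
    qed (use x1 der M in auto)
    show "mono_on {x1..x2} F \<or> antimono_on {x1..x2} F"
    proof (cases "x1 = x2")
      case False
      then have "z1 < z2" using inj[OF x1(1) x2(1)] x1 x2 z by fastforce
      then have z1: "z1 = \<phi> + of_int k * pi" by (auto simp: z1_def z2_def)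
      show ?thesis
      proof (rule sine_derivative_monotone[where j = k and M = M and \<psi> = \<psi> and \<phi> = \<phi>])
        fix x assume x: "x \<in> {x1..x2}"
        then have "z1 \<le> \<psi> x" "\<psi> x \<le> z2" using mono[of x1 x] mono[of x x2] x1 x2 by auto
        then show "\<phi> + of_int k * pi \<le> \<psi> x \<and> \<psi> x \<le> \<phi> + of_int (k + 1) * pi"
          using z1 by (auto simp: z2_def)
      qed (use x1 x2 der M in auto)
    qed (use triv in simp)
    show "mono_on {x2..\<omega>} F \<or> antimono_on {x2..\<omega>} F"
    proof (cases "x2 = \<omega>")
      case False
      then have "\<not> \<psi> \<omega> \<le> \<phi> + of_int (k + 1) * pi" using end2 by blast
      then have z2: "z2 = \<phi> + of_int (k + 1) * pi" unfolding z2_def by linarith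
      show ?thesis
      proof (rule sine_derivative_monotone[where j = "k + 1" and M = M and \<psi> = \<psi> and \<phi> = \<phi>])
        fix x assume x: "x \<in> {x2..\<omega>}"
        then have "z2 \<le> \<psi> x" "\<psi> x \<le> \<psi> \<omega>" using mono[of x2 x] mono[of x \<omega>] x2 by auto
        moreover have "\<psi> \<omega> \<le> \<phi> + of_int (k + 2) * pi"
          using rng k(1) unfolding pi(2) by linarith
        ultimately show "\<phi> + of_int (k + 1) * pi \<le> \<psi> x \<and> \<psi> x \<le> \<phi> + of_int (k + 1 + 1) * pi"
          using z2 by (auto simp: add.assoc)
      qed (use x2 der M in auto)
    qed (use triv in simp)
  qed
qed

text \<open>The conic with focus at the origin and polar equation \<open>r = 1 / (1 + B1 cos \<theta> + B2 sin \<theta>)\<close>, perturbed by the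
  factor \<open>exp (\<delta> \<kappa> \<theta>)\<close>, has tangent direction \<open>tangent_angle + pi / 2\<close> at polar angle \<open>\<theta>\<close>.\<close>
definition conic_denom :: "real \<Rightarrow> real \<Rightarrow> real \<Rightarrow> real" where
  "conic_denom B1 B2 \<theta> = 1 + B1 * cos \<theta> + B2 * sin \<theta>"

text \<open>Minus the logarithmic derivative of the radius \<open>1 / conic_denom\<close>. Its
  arctangent is the angle by which the tangent is rotated away from the perpendicular to the ray;
  the factor \<open>exp (\<delta> \<kappa>)\<close> changes the slope by minus \<delta> times the
  derivative of \<kappa>.\<close>

definition conic_slope :: "real \<Rightarrow> real \<Rightarrow> real \<Rightarrow> real" where
  "conic_slope B1 B2 \<theta> = (B2 * cos \<theta> - B1 * sin \<theta>) / conic_denom B1 B2 \<theta>"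

definition tangent_angle :: "real \<Rightarrow> real \<Rightarrow> real poly \<Rightarrow> real \<Rightarrow> real \<Rightarrow> real" where
  "tangent_angle B1 B2 \<kappa> \<delta> \<theta> = \<theta> + arctan (conic_slope B1 B2 \<theta> - \<delta> * poly (pderiv \<kappa>) \<theta>)"

text \<open>Lagrange's identity bounds the trigonometric part by the norm of
  \<open>(B1, B2)\<close>. The lower bound keeps the conic an ellipse; the upper bound makes
  \<open>1 / conic_denom\<close> exceed 1/2, the margin that the perturbation has to
  respect.\<close>

lemma conic_denom_bounds:
  assumes "B1\<^sup>2 + B2\<^sup>2 < 1"
  shows "0 < conic_denom B1 B2 \<theta>" "conic_denom B1 B2 \<theta> < 2"
proof -
  have "(B1 * cos \<theta> + B2 * sin \<theta>)\<^sup>2 \<le> (B1 * cos \<theta> + B2 * sin \<theta>)\<^sup>2 + (B2 * cos \<theta> - B1 * sin \<theta>)\<^sup>2" by simp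
  also have "\<dots> = (B1\<^sup>2 + B2\<^sup>2) * ((cos \<theta>)\<^sup>2 + (sin \<theta>)\<^sup>2)" by algebra
  also have "\<dots> < 1" using assms by simp
  finally have "\<bar>B1 * cos \<theta> + B2 * sin \<theta>\<bar> < 1" by (simp add: abs_square_less_1)
  then show "0 < conic_denom B1 B2 \<theta>" "conic_denom B1 B2 \<theta> < 2" by (auto simp: conic_denom_def)
qed

lemma conic_denom_deriv:
  "(conic_denom B1 B2 has_real_derivative (B2 * cos \<theta> - B1 * sin \<theta>)) (at \<theta>)"
  unfolding conic_denom_def by (auto intro!: derivative_eq_intros)

text \<open>The denominator \<open>U\<close> satisfies \<open>U'' = 1 - U\<close>, so the quotient
  rule yields a Riccati equation. In this form its square term cancels in the derivative of the
  tangent angle.\<close>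

lemma conic_slope_deriv:
  assumes "conic_denom B1 B2 \<theta> > 0"
  shows "(conic_slope B1 B2 has_real_derivative
           (1 / conic_denom B1 B2 \<theta> - 1 - (conic_slope B1 B2 \<theta>)\<^sup>2)) (at \<theta>)"
proof -
  have "(conic_slope B1 B2 has_real_derivative
     ((- B2 * sin \<theta> - B1 * cos \<theta>) * conic_denom B1 B2 \<theta> - (B2 * cos \<theta> - B1 * sin \<theta>) * (B2 * cos \<theta> - B1 * sin \<theta>)) /
       (conic_denom B1 B2 \<theta> * conic_denom B1 B2 \<theta>)) (at \<theta>)"
    unfolding conic_slope_def
    by (intro DERIV_divide conic_denom_deriv) (use assms in \<open>auto intro!: derivative_eq_intros\<close>)
  moreover have "- B2 * sin \<theta> - B1 * cos \<theta> = 1 - conic_denom B1 B2 \<theta>" by (simp add: conic_denom_def)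
  moreover have "((1 - U) * U - N * N) / (U * U) = 1 / U - 1 - (N / U)\<^sup>2" if "U \<noteq> 0" for U N :: real
    using that by (simp add: field_simps power2_eq_square)
  ultimately show ?thesis using assms by (simp only: conic_slope_def[of B1 B2 \<theta>])
qed

text \<open>The derivative is \<open>(1 + v\<^sup>2 + v') / (1 + v\<^sup>2)\<close>, and by the
  Riccati equation the unperturbed numerator is just \<open>1 / conic_denom\<close>, which is
  positive: this is the convexity of the conic. All other terms carry a factor \<delta>.\<close>

lemma tangent_angle_deriv:
  fixes \<kappa> :: "real poly" and \<delta> \<theta> :: real
  assumes "conic_denom B1 B2 \<theta> > 0"
  defines "v \<equiv> conic_slope B1 B2 \<theta> - \<delta> * poly (pderiv \<kappa>) \<theta>"
  shows "(tangent_angle B1 B2 \<kappa> \<delta> has_real_derivative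
     (1 / conic_denom B1 B2 \<theta> - \<delta> * (2 * conic_slope B1 B2 \<theta> * poly (pderiv \<kappa>) \<theta> + poly (pderiv (pderiv \<kappa>)) \<theta>)
       + (\<delta> * poly (pderiv \<kappa>) \<theta>)\<^sup>2) / (1 + v\<^sup>2)) (at \<theta>)"
proof -
  have "0 < 1 + v\<^sup>2" by (simp add: add_pos_nonneg)
  then have nz: "1 + v\<^sup>2 \<noteq> 0" by simp
  have "(tangent_angle B1 B2 \<kappa> \<delta> has_real_derivative
     (1 + inverse (1 + v\<^sup>2) * (1 / conic_denom B1 B2 \<theta> - 1 - (conic_slope B1 B2 \<theta>)\<^sup>2 -
        \<delta> * poly (pderiv (pderiv \<kappa>)) \<theta>))) (at \<theta>)"
    unfolding tangent_angle_def v_def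
    by (intro DERIV_add DERIV_ident DERIV_chain'[OF _ DERIV_arctan] DERIV_diff conic_slope_deriv[OF assms(1)]
       DERIV_cmult poly_DERIV)
  then show ?thesis
  proof (rule DERIV_cong)
    have "1 + inverse (1 + v\<^sup>2) * D = (1 + v\<^sup>2 + D) / (1 + v\<^sup>2)" for D
      using nz by (simp add: field_simps)
    moreover have "1 + v\<^sup>2 + (1 / conic_denom B1 B2 \<theta> - 1 - (conic_slope B1 B2 \<theta>)\<^sup>2 -
        \<delta> * poly (pderiv (pderiv \<kappa>)) \<theta>) = 1 / conic_denom B1 B2 \<theta> - \<delta> * (2 * conic_slope B1 B2 \<theta> * poly (pderiv \<kappa>) \<theta> + poly (pderiv (pderiv \<kappa>)) \<theta>)
       + (\<delta> * poly (pderiv \<kappa>) \<theta>)\<^sup>2"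
      unfolding v_def by (simp add: power2_eq_square algebra_simps)
    ultimately show "1 + inverse (1 + v\<^sup>2) * (1 / conic_denom B1 B2 \<theta> - 1 - (conic_slope B1 B2 \<theta>)\<^sup>2 -
        \<delta> * poly (pderiv (pderiv \<kappa>)) \<theta>) = (1 / conic_denom B1 B2 \<theta> - \<delta> * (2 * conic_slope B1 B2 \<theta> * poly (pderiv \<kappa>) \<theta> + poly (pderiv (pderiv \<kappa>)) \<theta>)
       + (\<delta> * poly (pderiv \<kappa>) \<theta>)\<^sup>2) / (1 + v\<^sup>2)"
      by simp
  qed
qed

lemma continuous_on_conic_slope:
  assumes "B1\<^sup>2 + B2\<^sup>2 < 1"
  shows "continuous_on A (conic_slope B1 B2)"
  using conic_slope_deriv[OF conic_denom_bounds(1)[OF assms]] 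
  by (meson DERIV_isCont continuous_at_imp_continuous_on)

text \<open>Let \<open>C\<close> bound the coefficient of \<delta> in the numerator on the compact
  interval. Once \<delta> < 1 / (2 C), the term linear in \<delta> costs less than 1/2, hence less
  than \<open>1 / conic_denom\<close>, and the quadratic term is nonnegative.\<close>

lemma eventually_strict_mono_tangent_angle:
  assumes B: "B1\<^sup>2 + B2\<^sup>2 < 1"
  shows "\<forall>\<^sub>F \<delta> in at_right 0. strict_mono_on {\<alpha>..\<omega>} (tangent_angle B1 B2 \<kappa> \<delta>)"
proof -
  let ?g = "\<lambda>\<theta>. 2 * conic_slope B1 B2 \<theta> * poly (pderiv \<kappa>) \<theta> + poly (pderiv (pderiv \<kappa>)) \<theta>"
  have "continuous_on {\<alpha>..\<omega>} ?g" by (intro continuous_intros continuous_on_conic_slope B)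
  then have "compact (?g ` {\<alpha>..\<omega>})" by (intro compact_continuous_image) auto
  then obtain C where C: "C > 0" "\<And>\<theta>. \<theta> \<in> {\<alpha>..\<omega>} \<Longrightarrow> \<bar>?g \<theta>\<bar> \<le> C"
    unfolding compact_eq_bounded_closed bounded_pos by auto
  have "\<forall>\<^sub>F \<delta> in at_right 0. \<delta> < 1 / (2 * C)" using C by (intro eventually_at_rightI[of 0 "1 / (2 * C)"]) auto
  moreover have "\<forall>\<^sub>F \<delta>::real in at_right 0. 0 < \<delta>" by (simp add: eventually_at_right_less)
  ultimately show ?thesis
  proof eventually_elim
    case (elim \<delta>)
    show ?case
    proof (rule strict_mono_onI)
      fix r s assume rs: "r \<in> {\<alpha>..\<omega>}" "s \<in> {\<alpha>..\<omega>}" "r < s"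
      show "tangent_angle B1 B2 \<kappa> \<delta> r < tangent_angle B1 B2 \<kappa> \<delta> s"
      proof (rule DERIV_pos_imp_increasing[OF rs(3)])
        fix \<theta> assume "r \<le> \<theta>" "\<theta> \<le> s"
        then have \<theta>: "\<theta> \<in> {\<alpha>..\<omega>}" using rs by auto
        have "\<delta> * ?g \<theta> \<le> \<delta> * C" using C(2)[OF \<theta>] elim by (intro mult_left_mono) auto
        also have "\<dots> < 1 / 2" using elim C by (simp add: field_simps)
        also have "\<dots> < 1 / conic_denom B1 B2 \<theta>" using conic_denom_bounds[OF B] by (simp add: field_simps)
        finally have "0 < 1 / conic_denom B1 B2 \<theta> - \<delta> * ?g \<theta> + (\<delta> * poly (pderiv \<kappa>) \<theta>)\<^sup>2"
          by (simp add: add_pos_nonneg)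
        moreover have "0 < 1 + (conic_slope B1 B2 \<theta> - \<delta> * poly (pderiv \<kappa>) \<theta>)\<^sup>2" by (simp add: add_pos_nonneg)
        ultimately show "\<exists>D. (tangent_angle B1 B2 \<kappa> \<delta> has_real_derivative D) (at \<theta>) \<and> 0 < D"
          using tangent_angle_deriv[OF conic_denom_bounds(1)[OF B]] by (blast intro: divide_pos_pos)
      qed
    qed
  qed
qed

lemma tangent_angle_zero_strict_mono:
  assumes B: "B1\<^sup>2 + B2\<^sup>2 < 1" and "r < s"
  shows "tangent_angle B1 B2 \<kappa> 0 r < tangent_angle B1 B2 \<kappa> 0 s"
proof (rule DERIV_pos_imp_increasing[OF assms(2)])
  fix \<theta>
  have "0 < 1 + (conic_slope B1 B2 \<theta>)\<^sup>2" by (simp add: add_pos_nonneg)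
  then show "\<exists>D. (tangent_angle B1 B2 \<kappa> 0 has_real_derivative D) (at \<theta>) \<and> 0 < D"
    using tangent_angle_deriv[OF conic_denom_bounds(1)[OF B], where \<theta> = \<theta> and \<kappa> = \<kappa> and \<delta> = 0] conic_denom_bounds(1)[OF B, of \<theta>]
    by (intro exI[of _ "1 / (conic_denom B1 B2 \<theta> * (1 + (conic_slope B1 B2 \<theta>)\<^sup>2))"] conjI) auto
qed

text \<open>Over a full period the tangent of the closed conic makes exactly one turn. As its angle
  is strictly increasing, a shorter arc turns by less.\<close>

lemma tangent_angle_zero_range:
  assumes B: "B1\<^sup>2 + B2\<^sup>2 < 1" and "\<omega> < \<alpha> + 2 * pi"
  shows "tangent_angle B1 B2 \<kappa> 0 \<omega> - tangent_angle B1 B2 \<kappa> 0 \<alpha> < 2 * pi"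
proof -
  have "tangent_angle B1 B2 \<kappa> 0 \<omega> < tangent_angle B1 B2 \<kappa> 0 (\<alpha> + 2 * pi)"
    using tangent_angle_zero_strict_mono assms by blast
  also have "\<dots> = tangent_angle B1 B2 \<kappa> 0 \<alpha> + 2 * pi"
    by (simp add: tangent_angle_def conic_slope_def conic_denom_def)
  finally show ?thesis by simp
qed

lemma eventually_tangent_angle_range:
  assumes "tangent_angle B1 B2 \<kappa> 0 \<omega> - tangent_angle B1 B2 \<kappa> 0 \<alpha> < R"
  shows "\<forall>\<^sub>F \<delta> in at_right 0. tangent_angle B1 B2 \<kappa> \<delta> \<omega> - tangent_angle B1 B2 \<kappa> \<delta> \<alpha> < R"
proof -
  have "((\<lambda>\<delta>. tangent_angle B1 B2 \<kappa> \<delta> \<omega> - tangent_angle B1 B2 \<kappa> \<delta> \<alpha>) \<longlongrightarrow>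
      tangent_angle B1 B2 \<kappa> 0 \<omega> - tangent_angle B1 B2 \<kappa> 0 \<alpha>) (at_right 0)"
    unfolding tangent_angle_def by (intro tendsto_intros)
  then show ?thesis using assms by (rule order_tendstoD)
qed

text \<open>In the limit \<open>\<beta> = 1\<close> the conic is a parabola, whose tangent direction turns at half the speed of the
  polar angle; an arc avoiding its axis direction therefore turns by less than \<open>pi\<close>.\<close>
lemma eventually_tangent_angle_parabola:
  assumes "0 < \<alpha>" "\<alpha> \<le> \<omega>" "\<omega> < 2 * pi"
  shows "\<forall>\<^sub>F \<beta> in at_left 1. tangent_angle (- \<beta>) 0 \<kappa> 0 \<omega> - tangent_angle (- \<beta>) 0 \<kappa> 0 \<alpha> < pi"
proof -
  have lim: "((\<lambda>\<beta>. tangent_angle (- \<beta>) 0 \<kappa> 0 \<theta>) \<longlongrightarrow> \<theta> / 2 + pi / 2) (at_left 1)"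
    if "0 < \<theta>" "\<theta> < 2 * pi" for \<theta>
  proof -
    have s: "0 < sin (\<theta> / 2)" using that by (intro sin_gt_zero) auto
    have c: "1 - cos \<theta> = 2 * (sin (\<theta> / 2))\<^sup>2" using cos_double_sin[of "\<theta> / 2"] by simp
    have "1 - 1 * cos \<theta> \<noteq> 0" using c s by simp
    then have "((\<lambda>\<beta>. \<theta> + arctan (\<beta> * sin \<theta> / (1 - \<beta> * cos \<theta>))) \<longlongrightarrow>
        \<theta> + arctan (1 * sin \<theta> / (1 - 1 * cos \<theta>))) (at_left 1)"
      by (intro tendsto_intros)
    \<comment> \<open>The quotient is the cotangent of \<theta>/2, that is, the tangent of \<pi>/2 -
      \<theta>/2, and this angle lies in the range of the arctangent precisely because \<theta>
      stays strictly between 0 and 2 \<pi>.\<close>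
    moreover have "arctan (sin \<theta> / (1 - cos \<theta>)) = pi / 2 - \<theta> / 2"
    proof -
      have "sin \<theta> = 2 * sin (\<theta> / 2) * cos (\<theta> / 2)" using sin_double[of "\<theta> / 2"] by simp
      then have "sin \<theta> / (1 - cos \<theta>) = cos (\<theta> / 2) / sin (\<theta> / 2)"
        unfolding c using s by (simp add: power2_eq_square)
      also have "\<dots> = tan (pi / 2 - \<theta> / 2)" by (simp add: tan_def sin_diff cos_diff)
      finally show ?thesis using that by (simp add: arctan_tan)
    qed
    ultimately show ?thesis
      by (simp add: tangent_angle_def conic_slope_def conic_denom_def algebra_simps)
  qed
  have "((\<lambda>\<beta>. tangent_angle (- \<beta>) 0 \<kappa> 0 \<omega> - tangent_angle (- \<beta>) 0 \<kappa> 0 \<alpha>) \<longlongrightarrow>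
     (\<omega> / 2 + pi / 2) - (\<alpha> / 2 + pi / 2)) (at_left 1)"
    using assms by (intro tendsto_diff lim) auto
  then show ?thesis by (rule order_tendstoD) (use assms in auto)
qed

text \<open>The derivative of the height is the speed along the curve times the component of
  \<open>(p1, p2)\<close> in the tangent direction. With \<open>(p1, p2)\<close> in polar form
  \<rho>, \<phi> and the tangent at \<open>tangent_angle + pi / 2\<close>, that component is minus
  \<rho> times the sine of \<open>tangent_angle - \<phi>\<close>, so the turning of the tangent is
  the phase that gets cut.\<close>

lemma perturbed_conic_pieces:
  fixes \<kappa> :: "real poly" and p1 p2 \<delta> :: real
  assumes B: "B1\<^sup>2 + B2\<^sup>2 < 1" and ab: "\<alpha> \<le> \<omega>"
    and sm: "strict_mono_on {\<alpha>..\<omega>} (tangent_angle B1 B2 \<kappa> \<delta>)"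
    and rng: "tangent_angle B1 B2 \<kappa> \<delta> \<omega> - tangent_angle B1 B2 \<kappa> \<delta> \<alpha> \<le> 2 * pi"
  defines "F \<equiv> \<lambda>\<theta>. exp (\<delta> * poly \<kappa> \<theta>) / conic_denom B1 B2 \<theta> * (p1 * cos \<theta> + p2 * sin \<theta>)"
  obtains x1 x2 where "\<alpha> \<le> x1" "x1 \<le> x2" "x2 \<le> \<omega>"
    "tangent_angle B1 B2 \<kappa> \<delta> \<omega> - tangent_angle B1 B2 \<kappa> \<delta> \<alpha> \<le> pi \<Longrightarrow> x2 = \<omega>"
    "mono_on {\<alpha>..x1} F \<or> antimono_on {\<alpha>..x1} F"
    "mono_on {x1..x2} F \<or> antimono_on {x1..x2} F"
    "mono_on {x2..\<omega>} F \<or> antimono_on {x2..\<omega>} F"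
proof -
  let ?p = "Complex p1 p2"
  define \<rho> \<phi> where "\<rho> = cmod ?p" and "\<phi> = Arg ?p"
  have "rcis \<rho> \<phi> = ?p" unfolding \<rho>_def \<phi>_def by (rule rcis_cmod_Arg)
  then have p: "p1 = \<rho> * cos \<phi>" "p2 = \<rho> * sin \<phi>" by (auto simp: rcis_def cis.ctr complex_eq_iff)
  let ?v = "\<lambda>\<theta>. conic_slope B1 B2 \<theta> - \<delta> * poly (pderiv \<kappa>) \<theta>"
  let ?R = "\<lambda>\<theta>. exp (\<delta> * poly \<kappa> \<theta>) / conic_denom B1 B2 \<theta>"
  have Upos: "conic_denom B1 B2 \<theta> > 0" for \<theta> using conic_denom_bounds[OF B] by simp
  have der: "(F has_real_derivative - (?R \<theta> * \<rho> * sqrt (1 + (?v \<theta>)\<^sup>2) * sin (tangent_angle B1 B2 \<kappa> \<delta> \<theta> - \<phi>))) (at \<theta>)" for \<theta>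
  proof -
    have nz: "sqrt (1 + (?v \<theta>)\<^sup>2) \<noteq> 0" by (simp add: add_nonneg_eq_0_iff)
    have "(?R has_real_derivative (exp (\<delta> * poly \<kappa> \<theta>) * (\<delta> * poly (pderiv \<kappa>) \<theta>) * conic_denom B1 B2 \<theta> -
        exp (\<delta> * poly \<kappa> \<theta>) * (B2 * cos \<theta> - B1 * sin \<theta>)) / (conic_denom B1 B2 \<theta> * conic_denom B1 B2 \<theta>)) (at \<theta>)"
      using Upos[of \<theta>] by (intro DERIV_divide conic_denom_deriv DERIV_fun_exp DERIV_cmult poly_DERIV) auto
    moreover have "(exp (\<delta> * poly \<kappa> \<theta>) * (\<delta> * poly (pderiv \<kappa>) \<theta>) * conic_denom B1 B2 \<theta> -
        exp (\<delta> * poly \<kappa> \<theta>) * (B2 * cos \<theta> - B1 * sin \<theta>)) / (conic_denom B1 B2 \<theta> * conic_denom B1 B2 \<theta>) = - (?R \<theta> * ?v \<theta>)"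
      using Upos[of \<theta>] by (simp add: conic_slope_def field_simps)
    ultimately have "(?R has_real_derivative - (?R \<theta> * ?v \<theta>)) (at \<theta>)" by simp
    moreover have "((\<lambda>\<theta>. p1 * cos \<theta> + p2 * sin \<theta>) has_real_derivative (- p1 * sin \<theta> + p2 * cos \<theta>)) (at \<theta>)"
      by (auto intro!: derivative_eq_intros)
    ultimately have "(F has_real_derivative - (?R \<theta> * ?v \<theta>) * (p1 * cos \<theta> + p2 * sin \<theta>) +
        (- p1 * sin \<theta> + p2 * cos \<theta>) * ?R \<theta>) (at \<theta>)" unfolding F_def by (rule DERIV_mult)
    then show ?thesis
    proof (rule DERIV_cong)
      have "sqrt (1 + (?v \<theta>)\<^sup>2) * sin ((\<theta> - \<phi>) + arctan (?v \<theta>)) = sin (\<theta> - \<phi>) + ?v \<theta> * cos (\<theta> - \<phi>)"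
        using nz by (simp only: sin_add sin_arctan cos_arctan) (simp add: field_simps)
      moreover have "(\<theta> - \<phi>) + arctan (?v \<theta>) = tangent_angle B1 B2 \<kappa> \<delta> \<theta> - \<phi>" by (simp add: tangent_angle_def)
      ultimately have e: "sqrt (1 + (?v \<theta>)\<^sup>2) * sin (tangent_angle B1 B2 \<kappa> \<delta> \<theta> - \<phi>) = sin (\<theta> - \<phi>) + ?v \<theta> * cos (\<theta> - \<phi>)" by simp
      have "p1 * cos \<theta> + p2 * sin \<theta> = \<rho> * cos (\<theta> - \<phi>)" "- p1 * sin \<theta> + p2 * cos \<theta> = - \<rho> * sin (\<theta> - \<phi>)"
        by (simp_all add: p cos_diff sin_diff algebra_simps)
      moreover have "- (R * v) * (\<rho> * c) + (- \<rho> * s) * R = - (R * \<rho> * (s + v * c))" for R v c s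
        by (simp add: algebra_simps)
      ultimately have "- (?R \<theta> * ?v \<theta>) * (p1 * cos \<theta> + p2 * sin \<theta>) + (- p1 * sin \<theta> + p2 * cos \<theta>) * ?R \<theta>
          = - (?R \<theta> * \<rho> * (sin (\<theta> - \<phi>) + ?v \<theta> * cos (\<theta> - \<phi>)))" by (simp only:)
      then show "- (?R \<theta> * ?v \<theta>) * (p1 * cos \<theta> + p2 * sin \<theta>) + (- p1 * sin \<theta> + p2 * cos \<theta>) * ?R \<theta>
         = - (?R \<theta> * \<rho> * sqrt (1 + (?v \<theta>)\<^sup>2) * sin (tangent_angle B1 B2 \<kappa> \<delta> \<theta> - \<phi>))"
        unfolding e[symmetric] by (simp only: mult.assoc)
    qed
  qed
  have "continuous_on {\<alpha>..\<omega>} (tangent_angle B1 B2 \<kappa> \<delta>)"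
    unfolding tangent_angle_def by (intro continuous_intros continuous_on_conic_slope B)
  then show ?thesis
    using sine_derivative_pieces[OF ab _ sm rng der, of thesis] that Upos \<rho>_def
    by (simp add: less_imp_le)
qed

lemma monotone_piece_compose:
  fixes \<theta> F g :: "real \<Rightarrow> real"
  assumes F: "mono_on {\<theta> y..\<theta> y'} F \<or> antimono_on {\<theta> y..\<theta> y'} F"
    and \<theta>: "strict_mono_on {a..b} \<theta>" and y: "{y..y'} \<subseteq> {a..b}" and g: "\<And>s. s \<in> {a..b} \<Longrightarrow> g s = F (\<theta> s)"
  shows "mono_on {y..y'} g \<or> antimono_on {y..y'} g"
proof -
  have m: "\<theta> r \<le> \<theta> s" if "r \<in> {y..y'}" "s \<in> {y..y'}" "r \<le> s" for r s
    using strict_mono_on_leD[OF \<theta>, of r s] that y by auto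
  have im: "\<theta> s \<in> {\<theta> y..\<theta> y'}" if "s \<in> {y..y'}" for s
    using m[of y s] m[of s y'] that by auto
  from F show ?thesis
  proof
    assume F: "mono_on {\<theta> y..\<theta> y'} F"
    have "g r \<le> g s" if "r \<in> {y..y'}" "s \<in> {y..y'}" "r \<le> s" for r s
      using monotone_onD[OF F im im m] that g y by auto
    then show ?thesis by (auto simp: monotone_on_def)
  next
    assume F: "antimono_on {\<theta> y..\<theta> y'} F"
    have "g s \<le> g r" if "r \<in> {y..y'}" "s \<in> {y..y'}" "r \<le> s" for r s
      using monotone_onD[OF F im im m] that g y by auto
    then show ?thesis by (auto simp: monotone_on_def)
  qed
qed

lemma arc_height_pieces:
  fixes \<theta> g :: "real \<Rightarrow> real" and p1 p2 :: real
  assumes ab: "a \<le> b" and B: "B1\<^sup>2 + B2\<^sup>2 < 1" and c: "continuous_on {a..b} \<theta>" and \<theta>: "strict_mono_on {a..b} \<theta>"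
    and sm: "strict_mono_on {\<theta> a..\<theta> b} (tangent_angle B1 B2 \<kappa> \<delta>)"
    and rng: "tangent_angle B1 B2 \<kappa> \<delta> (\<theta> b) - tangent_angle B1 B2 \<kappa> \<delta> (\<theta> a) \<le> 2 * pi"
    and g: "\<And>s. s \<in> {a..b} \<Longrightarrow>
      g s = exp (\<delta> * poly \<kappa> (\<theta> s)) / conic_denom B1 B2 (\<theta> s) * (p1 * cos (\<theta> s) + p2 * sin (\<theta> s))"
  obtains y1 y2 where "a \<le> y1" "y1 \<le> y2" "y2 \<le> b"
    "tangent_angle B1 B2 \<kappa> \<delta> (\<theta> b) - tangent_angle B1 B2 \<kappa> \<delta> (\<theta> a) \<le> pi \<Longrightarrow> y2 = b"
    "mono_on {a..y1} g \<or> antimono_on {a..y1} g"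
    "mono_on {y1..y2} g \<or> antimono_on {y1..y2} g"
    "mono_on {y2..b} g \<or> antimono_on {y2..b} g"
proof -
  define F where "F = (\<lambda>\<theta>. exp (\<delta> * poly \<kappa> \<theta>) / conic_denom B1 B2 \<theta> * (p1 * cos \<theta> + p2 * sin \<theta>))"
  have le: "\<theta> a \<le> \<theta> b" using strict_mono_on_leD[OF \<theta>, of a b] ab by auto
  obtain x1 x2 where x: "\<theta> a \<le> x1" "x1 \<le> x2" "x2 \<le> \<theta> b"
    "tangent_angle B1 B2 \<kappa> \<delta> (\<theta> b) - tangent_angle B1 B2 \<kappa> \<delta> (\<theta> a) \<le> pi \<Longrightarrow> x2 = \<theta> b"
    "mono_on {\<theta> a..x1} F \<or> antimono_on {\<theta> a..x1} F"
    "mono_on {x1..x2} F \<or> antimono_on {x1..x2} F"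
    "mono_on {x2..\<theta> b} F \<or> antimono_on {x2..\<theta> b} F"
    using perturbed_conic_pieces[OF B le sm rng, of p1 p2, folded F_def] by blast
  obtain y1 where y1: "y1 \<in> {a..b}" "\<theta> y1 = x1" using IVT'[of \<theta> a x1 b] x(1-3) ab c by auto
  obtain y2 where y2: "y2 \<in> {a..b}" "\<theta> y2 = x2" using IVT'[of \<theta> a x2 b] x(1-3) ab c by auto
  have inj: "r = s" if "r \<in> {a..b}" "s \<in> {a..b}" "\<theta> r = \<theta> s" for r s
    using inj_onD[OF strict_mono_on_imp_inj_on[OF \<theta>] that(3)] that by blast
  have 12: "y1 \<le> y2"
    using strict_mono_onD[OF \<theta>, of y2 y1] y1 y2 x(2) by (metis not_le)
  have gF: "g s = F (\<theta> s)" if "s \<in> {a..b}" for s using g[OF that] by (simp add: F_def)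
  show ?thesis
  proof (rule that[of y1 y2])
    show "a \<le> y1" "y1 \<le> y2" "y2 \<le> b" using y1 y2 12 by auto
    show "y2 = b" if "tangent_angle B1 B2 \<kappa> \<delta> (\<theta> b) - tangent_angle B1 B2 \<kappa> \<delta> (\<theta> a) \<le> pi"
      using inj[of y2 b] x(4)[OF that] y2 ab by auto
    show "mono_on {a..y1} g \<or> antimono_on {a..y1} g"
      by (rule monotone_piece_compose[where a = a and b = b and \<theta> = \<theta> and F = F, OF _ \<theta> _ gF]) (use x(5) y1 in auto)
    show "mono_on {y1..y2} g \<or> antimono_on {y1..y2} g"
      by (rule monotone_piece_compose[where a = a and b = b and \<theta> = \<theta> and F = F, OF _ \<theta> _ gF]) (use x(6) y1 y2 in auto)
    show "mono_on {y2..b} g \<or> antimono_on {y2..b} g"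
      by (rule monotone_piece_compose[where a = a and b = b and \<theta> = \<theta> and F = F, OF _ \<theta> _ gF]) (use x(7) y2 in auto)
  qed
qed

text \<open>Maxima are detected just before their left end or just after their right end, so the
  chosen piece must extend strictly to that side; hence one half-open version for each side. A piece
  of length zero is never chosen.\<close>

lemma partition_left_cover:
  fixes t :: "nat \<Rightarrow> real"
  assumes "t 0 < l" "l \<le> t n"
  shows "\<exists>i<n. t i < l \<and> l \<le> t (Suc i)"
  using assms
proof (induction n)
  case (Suc n)
  then show ?case by (cases "l \<le> t n") (auto intro: less_SucI)
qed simp

lemma partition_right_cover:
  fixes t :: "nat \<Rightarrow> real"
  assumes "t 0 \<le> l" "l < t n"
  shows "\<exists>i<n. t i \<le> l \<and> l < t (Suc i)"
  using assms
proof (induction n)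
  case (Suc n)
  then show ?case by (cases "l < t n") (auto intro: less_SucI)
qed simp

section \<open>Counting local maxima by monotone pieces\<close>

text \<open>Models the preimage in the line of a local maximum set on the circle, which is why it is
  invariant under translation by 1. The whole line, which arises from constant height, is excluded:
  it has no ends at which to see a rise or a fall.\<close>

definition plateau_max :: "(real \<Rightarrow> real) \<Rightarrow> real set \<Rightarrow> bool" where
  "plateau_max G T \<longleftrightarrow> closed T \<and> T \<noteq> {} \<and> T \<noteq> UNIV \<and> (\<forall>x. x + 1 \<in> T \<longleftrightarrow> x \<in> T) \<and>
     (\<exists>c U. open U \<and> T \<subseteq> U \<and> (\<forall>x\<in>T. G x = c) \<and> (\<forall>x\<in>U - T. G x < c))"

lemma plateau_maxE:
  assumes "plateau_max G T"
  obtains c U where "closed T" "T \<noteq> {}" "T \<noteq> UNIV" "\<And>x. x + 1 \<in> T \<longleftrightarrow> x \<in> T"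
    "open U" "T \<subseteq> U" "\<And>x. x \<in> T \<Longrightarrow> G x = c" "\<And>x. x \<in> U - T \<Longrightarrow> G x < c"
proof -
  obtain c U where "open U \<and> T \<subseteq> U \<and> (\<forall>x\<in>T. G x = c) \<and> (\<forall>x\<in>U - T. G x < c)"
    using assms unfolding plateau_max_def by (elim conjE exE) (rule that, intro conjI)
  then show ?thesis using assms by (intro that[of U c]) (auto simp: plateau_max_def)
qed

lemma periodic_of_int:
  fixes T :: "real set" and k :: int
  assumes "\<And>x. x + 1 \<in> T \<longleftrightarrow> x \<in> T"
  shows "x + of_int k \<in> T \<longleftrightarrow> x \<in> T"
proof (induction k rule: int_induct[of _ 0])
  case (step1 i)
  then show ?case using assms[of "x + of_int i"] by (simp add: algebra_simps)
next
  case (step2 i)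
  then show ?case using assms[of "x + of_int (i - 1)"] by (simp add: algebra_simps)
qed simp

text \<open>Start at a point \<open>w\<close> outside \<open>T\<close>, take the first point of
  \<open>T\<close> after it, and translate by an integer into the half-open unit interval.\<close>

lemma periodic_left_end:
  fixes T :: "real set"
  assumes "closed T" "T \<noteq> {}" "T \<noteq> UNIV" and per: "\<And>x. x + 1 \<in> T \<longleftrightarrow> x \<in> T"
  obtains l w where "0 < l" "l \<le> 1" "l \<in> T" "w < l" "\<And>x. w < x \<Longrightarrow> x < l \<Longrightarrow> x \<notin> T"
proof -
  obtain w s where w: "w \<notin> T" and s: "s \<in> T" using assms by blast
  define s' where "s' = s + of_int \<lceil>w - s\<rceil>"
  have s': "s' \<in> T" "w \<le> s'"
    using periodic_of_int[of T s "\<lceil>w - s\<rceil>", OF per] s by (simp_all add: s'_def) linarith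
  define A where "A = T \<inter> {w..s'}"
  have A: "closed A" "A \<noteq> {}" "bdd_below A"
    using s' assms(1) by (auto simp: A_def intro!: closed_Int)
  define l where "l = Inf A"
  have lA: "l \<in> A" unfolding l_def using closed_contains_Inf A by blast
  then have wl: "w < l" using w by (auto simp: A_def order_le_less)
  have out: "x \<notin> T" if "w < x" "x < l" for x
  proof
    assume "x \<in> T"
    with that lA have "x \<in> A" by (auto simp: A_def)
    then have "l \<le> x" unfolding l_def using A(3) cInf_lower by blast
    with that show False by simp
  qed
  define k where "k = 1 - \<lceil>l\<rceil>"
  show ?thesis
  proof (rule that[of "l + of_int k" "w + of_int k"])
    show "0 < l + of_int k" "l + of_int k \<le> 1" unfolding k_def by linarith+
    show "l + of_int k \<in> T" using lA periodic_of_int[of T, OF per] by (auto simp: A_def)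
    show "w + of_int k < l + of_int k" using wl by simp
    fix x assume "w + of_int k < x" "x < l + of_int k"
    then have "x - of_int k \<notin> T" using out by simp
    then show "x \<notin> T" using periodic_of_int[of T "x - of_int k" k, OF per] by simp
  qed
qed

text \<open>The height just before a left end of \<open>T\<close> is smaller than on
  \<open>T\<close>, so the piece reaching that end from the left cannot be decreasing. Two disjoint
  plateaus cannot share such a piece: leaving the left one, the height would drop inside a rising
  piece. Demanding that the piece is not also decreasing rules out constant pieces, so that rising
  and falling pieces can later be counted separately.\<close>

lemma plateau_max_rising_piece:
  fixes G :: "real \<Rightarrow> real"
  assumes F: "\<And>T. T \<in> F \<Longrightarrow> plateau_max G T" and disj: "disjoint F"
    and cover: "\<And>l. 0 < l \<Longrightarrow> l \<le> 1 \<Longrightarrow> \<exists>k\<in>Q. a k < l \<and> l \<le> b k"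
    and mono: "\<And>k. k \<in> Q \<Longrightarrow> mono_on {a k..b k} G \<or> antimono_on {a k..b k} G"
  obtains \<phi> where "inj_on \<phi> F" "\<phi> ` F \<subseteq> {k\<in>Q. mono_on {a k..b k} G \<and> \<not> antimono_on {a k..b k} G}"
proof -
  define R where "R = {k\<in>Q. mono_on {a k..b k} G \<and> \<not> antimono_on {a k..b k} G}"
  have ex: "\<exists>k l. k \<in> R \<and> l \<in> T \<and> a k < l \<and> l \<le> b k" if T: "T \<in> F" for T
  proof -
    obtain c U where T1: "closed T" "T \<noteq> {}" "T \<noteq> UNIV" "\<And>x. x + 1 \<in> T \<longleftrightarrow> x \<in> T"
      and U: "open U" "T \<subseteq> U" "\<And>x. x \<in> T \<Longrightarrow> G x = c" "\<And>x. x \<in> U - T \<Longrightarrow> G x < c"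
      by (rule plateau_maxE[OF F[OF T]]) (rule that)
    obtain l w where l: "0 < l" "l \<le> 1" "l \<in> T" "w < l" "\<And>x. w < x \<Longrightarrow> x < l \<Longrightarrow> x \<notin> T"
      using periodic_left_end[OF T1] by blast
    obtain k where k: "k \<in> Q" "a k < l" "l \<le> b k" using cover l by blast
    obtain e where e: "e > 0" "ball l e \<subseteq> U" using U l(3) openE by blast
    obtain x where "max (max (a k) w) (l - e) < x" and x': "x < l"
      using dense[of "max (max (a k) w) (l - e)" l] k l e by auto
    then have x: "a k < x" "w < x" "l - e < x" "x < l" by auto
    then have "x \<in> U - T" using e l by (auto simp: dist_real_def subset_iff)
    then have "G x < G l" using U l by auto
    then have "\<not> antimono_on {a k..b k} G" using x k unfolding monotone_on_def
      by (meson atLeastAtMost_iff less_le_trans less_imp_le not_le order_trans)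
    with mono[OF k(1)] k l show ?thesis unfolding R_def by blast
  qed
  then obtain \<phi> \<tau> where \<phi>: "\<And>T. T \<in> F \<Longrightarrow> \<phi> T \<in> R \<and> \<tau> T \<in> T \<and> a (\<phi> T) < \<tau> T \<and> \<tau> T \<le> b (\<phi> T)"
    by metis
  have no: False if T: "T \<in> F" "T' \<in> F" "T \<noteq> T'" "\<phi> T = \<phi> T'" "\<tau> T \<le> \<tau> T'" for T T'
  proof -
    obtain c U where cl: "closed T"
      and U: "open U" "T \<subseteq> U" "\<And>x. x \<in> T \<Longrightarrow> G x = c" "\<And>x. x \<in> U - T \<Longrightarrow> G x < c"
      by (rule plateau_maxE[OF F[OF T(1)]]) (rule that)
    have nin: "\<tau> T' \<notin> T" using \<phi>[OF T(2)] disj T unfolding disjoint_def by blast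
    \<comment> \<open>The last point \<open>e\<close> of the left plateau before the right one;
      immediately after it the height falls strictly while the argument is still inside the common
      rising piece.\<close>
    define A where "A = T \<inter> {\<tau> T..\<tau> T'}"
    have A: "closed A" "\<tau> T \<in> A" "bdd_above A" using \<phi>[OF T(1)] T(5) cl by (auto simp: A_def)
    define e where "e = Sup A"
    have eA: "e \<in> A" unfolding e_def using closed_contains_Sup A by blast
    have lt: "e < \<tau> T'" using eA nin by (auto simp: A_def order_le_less)
    obtain d where d: "d > 0" "ball e d \<subseteq> U" using U eA openE unfolding A_def by blast
    obtain y where "e < y" and "y < min (e + d) (\<tau> T')"
      using dense[of e "min (e + d) (\<tau> T')"] lt d by auto
    then have y: "e < y" "y < e + d" "y < \<tau> T'" by auto
    have "y \<notin> T"
    proof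
      assume "y \<in> T"
      then have "y \<in> A" using y eA by (auto simp: A_def)
      then show False using y A cSup_upper unfolding e_def by fastforce
    qed
    then have "y \<in> U - T" using d y by (auto simp: dist_real_def subset_iff)
    then have "G y < G e" using U eA by (auto simp: A_def)
    have m: "mono_on {a (\<phi> T)..b (\<phi> T)} G" using \<phi>[OF T(1)] unfolding R_def by blast
    have "\<tau> T \<le> e" using eA unfolding A_def by simp
    then have "a (\<phi> T) \<le> e" using \<phi>[OF T(1)] by linarith
    moreover have "y \<le> b (\<phi> T)" using \<phi>[OF T(2)] y(3) unfolding T(4) by linarith
    ultimately have "G e \<le> G y" using y(1) by (intro monotone_onD[OF m]) auto
    with \<open>G y < G e\<close> show False by simp
  qed
  show ?thesis
  proof (rule that[of \<phi>])
    show "inj_on \<phi> F"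
    proof (rule inj_onI)
      fix T T' assume *: "T \<in> F" "T' \<in> F" "\<phi> T = \<phi> T'"
      show "T = T'"
      proof (cases "\<tau> T \<le> \<tau> T'")
        case True then show ?thesis using no[of T T'] * by blast
      next
        case False then show ?thesis using no[of T' T] * by fastforce
      qed
    qed
    show "\<phi> ` F \<subseteq> {k\<in>Q. mono_on {a k..b k} G \<and> \<not> antimono_on {a k..b k} G}"
      using \<phi> unfolding R_def by blast
  qed
qed

lemma plateau_max_reflect:
  assumes "plateau_max G T"
  shows "plateau_max (\<lambda>x. G (1 - x)) ((\<lambda>x. 1 - x) -` T)"
proof -
  let ?r = "\<lambda>x::real. 1 - x"
  obtain c U where T: "closed T" "T \<noteq> {}" "T \<noteq> UNIV" "\<And>x. x + 1 \<in> T \<longleftrightarrow> x \<in> T"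
      and U: "open U" "T \<subseteq> U" "\<And>x. x \<in> T \<Longrightarrow> G x = c" "\<And>x. x \<in> U - T \<Longrightarrow> G x < c"
      by (rule plateau_maxE[OF assms]) (rule that)
  have c: "continuous_on UNIV ?r" by (intro continuous_intros)
  have "closed (?r -` T)" using closed_vimage[OF T(1) c] .
  moreover have "open (?r -` U)" using open_vimage[OF U(1) c] .
  moreover obtain x y where "x \<in> T" "y \<notin> T" using T by blast
  then have "1 - x \<in> ?r -` T" "1 - y \<notin> ?r -` T" by auto
  then have "?r -` T \<noteq> {}" "?r -` T \<noteq> UNIV" by blast+
  moreover have "x + 1 \<in> ?r -` T \<longleftrightarrow> x \<in> ?r -` T" for x
    using T(4)[of "- x"] by (simp add: add.commute)
  ultimately show ?thesis
    unfolding plateau_max_def using U by (intro conjI allI exI[of _ c] exI[of _ "?r -` U"]) auto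
qed

text \<open>Left ends inject the plateaus into the strictly rising pieces. The reflection
  \<open>x \<mapsto> 1 - x\<close> swaps left and right ends, rising and falling pieces, and the two
  kinds of half-open cover, so it also injects them into the strictly falling pieces. These two
  classes are disjoint.\<close>

lemma card_plateau_max_le:
  fixes G :: "real \<Rightarrow> real"
  assumes F: "\<And>T. T \<in> F \<Longrightarrow> plateau_max G T" and disj: "disjoint F" and Q: "finite Q"
    and coverl: "\<And>l. 0 < l \<Longrightarrow> l \<le> 1 \<Longrightarrow> \<exists>k\<in>Q. a k < l \<and> l \<le> b k"
    and coverr: "\<And>l. 0 \<le> l \<Longrightarrow> l < 1 \<Longrightarrow> \<exists>k\<in>Q. a k \<le> l \<and> l < b k"
    and mono: "\<And>k. k \<in> Q \<Longrightarrow> mono_on {a k..b k} G \<or> antimono_on {a k..b k} G"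
  shows "finite F \<and> 2 * card F \<le> card Q"
proof -
  define F' where "F' = (\<lambda>T. (\<lambda>x::real. 1 - x) -` T) ` F"
  have invol: "(\<lambda>x::real. 1 - x) -` ((\<lambda>x. 1 - x) -` T) = T" for T by auto
  have inj: "inj_on (\<lambda>T. (\<lambda>x::real. 1 - x) -` T) F" by (rule inj_onI) (metis invol)
  let ?I = "{k\<in>Q. mono_on {a k..b k} G \<and> \<not> antimono_on {a k..b k} G}"
  let ?D = "{k\<in>Q. antimono_on {a k..b k} G \<and> \<not> mono_on {a k..b k} G}"
  obtain \<phi> where \<phi>: "inj_on \<phi> F" "\<phi> ` F \<subseteq> ?I"
    using plateau_max_rising_piece[of F G Q a b] F disj coverl mono by blast
  have m1: "mono_on {1 - b k..1 - a k} (\<lambda>x. G (1 - x)) \<longleftrightarrow> antimono_on {a k..b k} G" for k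
  proof
    assume *: "mono_on {1 - b k..1 - a k} (\<lambda>x. G (1 - x))"
    show "antimono_on {a k..b k} G"
    proof (rule monotone_onI)
      fix x y assume "x \<in> {a k..b k}" "y \<in> {a k..b k}" "x \<le> y"
      then show "G y \<le> G x" using monotone_onD[OF *, of "1 - y" "1 - x"] by auto
    qed
  qed (auto simp: monotone_on_def)
  have m2: "antimono_on {1 - b k..1 - a k} (\<lambda>x. G (1 - x)) \<longleftrightarrow> mono_on {a k..b k} G" for k
  proof
    assume *: "antimono_on {1 - b k..1 - a k} (\<lambda>x. G (1 - x))"
    show "mono_on {a k..b k} G"
    proof (rule monotone_onI)
      fix x y assume "x \<in> {a k..b k}" "y \<in> {a k..b k}" "x \<le> y"
      then show "G x \<le> G y" using monotone_onD[OF *, of "1 - y" "1 - x"] by auto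
    qed
  qed (auto simp: monotone_on_def)
  obtain \<psi> where \<psi>: "inj_on \<psi> F'" "\<psi> ` F' \<subseteq> ?D"
  proof (rule plateau_max_rising_piece[of F' "\<lambda>x. G (1 - x)" Q "\<lambda>k. 1 - b k" "\<lambda>k. 1 - a k"])
    show "plateau_max (\<lambda>x. G (1 - x)) T" if "T \<in> F'" for T
      using that F plateau_max_reflect unfolding F'_def by blast
    show "disjoint F'"
    proof (rule disjointI)
      fix A B assume "A \<in> F'" "B \<in> F'" "A \<noteq> B"
      then obtain T T' where "T \<in> F" "T' \<in> F" "A = (\<lambda>x. 1 - x) -` T" "B = (\<lambda>x. 1 - x) -` T'" "T \<noteq> T'"
        unfolding F'_def by blast
      then show "A \<inter> B = {}" using disj unfolding disjoint_def by blast
    qed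
    fix l :: real assume "0 < l" "l \<le> 1"
    then obtain k where "k \<in> Q" "a k \<le> 1 - l" "1 - l < b k" using coverr[of "1 - l"] by auto
    then show "\<exists>k\<in>Q. 1 - b k < l \<and> l \<le> 1 - a k" by (intro bexI[of _ k]) auto
  next
    fix k assume "k \<in> Q" 
    then show "mono_on {1 - b k..1 - a k} (\<lambda>x. G (1 - x)) \<or> antimono_on {1 - b k..1 - a k} (\<lambda>x. G (1 - x))"
      unfolding m1 m2 using mono by blast
  next
    fix \<phi> :: "real set \<Rightarrow> 'a"
    assume *: "inj_on \<phi> F'" "\<phi> ` F' \<subseteq> {k\<in>Q. mono_on {1 - b k..1 - a k} (\<lambda>x. G (1 - x)) \<and> \<not> antimono_on {1 - b k..1 - a k} (\<lambda>x. G (1 - x))}"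
    show thesis by (rule that[OF *(1)]) (use *(2) in \<open>unfold m1 m2\<close>)
  qed
  have fin: "finite F" by (rule inj_on_finite[OF \<phi>]) (use Q in simp)
  have "card F \<le> card ?I" using \<phi> Q by (intro card_inj_on_le[of \<phi>]) auto
  moreover have "card F \<le> card ?D"
    using \<psi> Q card_image[OF inj] card_inj_on_le[of \<psi> F' ?D] unfolding F'_def by auto
  moreover have "card ?I + card ?D = card (?I \<union> ?D)" using Q by (intro card_Un_disjoint[symmetric]) auto
  moreover have "card (?I \<union> ?D) \<le> card Q" using Q by (intro card_mono) auto
  ultimately show ?thesis using fin by linarith
qed

text \<open>A common point makes the two heights equal, so inside the neighbourhood \<open>U\<close>
  the set \<open>J'\<close> cannot leave \<open>J\<close>. Thus \<open>J' \<inter> J\<close> is open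
  and closed in the connected set \<open>J'\<close>.\<close>

lemma local_max_set_subset_if_meet:
  assumes J: "local_max_set f p J" and J': "local_max_set f p J'" and meet: "J \<inter> J' \<noteq> {}"
  shows "J' \<subseteq> J"
proof -
  obtain c U where "closed J" and c: "\<forall>z\<in>J. f z \<bullet> p = c"
    and U: "open U" "J \<subseteq> U" "\<forall>z\<in>(U \<inter> S1) - J. f z \<bullet> p < c"
    using J unfolding local_max_set_def by blast
  obtain c' where c': "\<forall>z\<in>J'. f z \<bullet> p = c'" and J'': "J' \<subseteq> S1" "connected J'"
    using J' unfolding local_max_set_def by blast
  have "c' = c" using meet c c' by auto
  then have eq: "J' \<inter> U = J' \<inter> J" using U c' J'' by fastforce
  have "openin (top_of_set J') (J' \<inter> J)" using U(1) eq by (metis openin_open)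
  moreover have "closedin (top_of_set J') (J' \<inter> J)" using \<open>closed J\<close> by (simp add: closedin_closed_Int)
  ultimately have "J' \<inter> J = {} \<or> J' \<inter> J = J'" using J''(2) connected_clopen by blast
  then show ?thesis using meet by blast
qed

lemma br_le_monotone_pieces:
  assumes Q: "finite Q" "card Q \<ge> 2"
    and coverl: "\<And>l. 0 < l \<Longrightarrow> l \<le> 1 \<Longrightarrow> \<exists>k\<in>Q. a k < l \<and> l \<le> b k"
    and coverr: "\<And>l. 0 \<le> l \<Longrightarrow> l < 1 \<Longrightarrow> \<exists>k\<in>Q. a k \<le> l \<and> l < b k"
    and mono: "\<And>k. k \<in> Q \<Longrightarrow> mono_on {a k..b k} (\<lambda>s. f (cis (2 * pi * s)) \<bullet> p) \<or>
                 antimono_on {a k..b k} (\<lambda>s. f (cis (2 * pi * s)) \<bullet> p)"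
  shows "br f p \<le> enat (card Q div 2)"
proof -
  let ?L = "{J. local_max_set f p J}"
  let ?e = "\<lambda>s::real. cis (2 * pi * s)"
  have eq: "J = J'" if "J \<in> ?L" "J' \<in> ?L" "J \<inter> J' \<noteq> {}" for J J'
    using local_max_set_subset_if_meet[of f p J J'] local_max_set_subset_if_meet[of f p J' J] that by blast
  have surj: "\<exists>s. z = ?e s" if "z \<in> S1" for z
  proof -
    have "z = cis (Arg z)" using that rcis_cmod_Arg[of z] by (simp add: rcis_def)
    then have "z = ?e (Arg z / (2 * pi))" by simp
    then show ?thesis by blast
  qed
  have "finite ?L \<and> 2 * card ?L \<le> card Q"
  proof (cases "S1 \<in> ?L")
    case True
    \<comment> \<open>Constant height: the whole circle is the only maximum, because any other would
      meet it. The count 1 is covered by the assumption of at least two pieces.\<close>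
    have "?L = {S1}"
    proof -
      have "J = S1" if "J \<in> ?L" for J using eq[OF that True] that unfolding local_max_set_def by blast
      with True show ?thesis by blast
    qed
    then show ?thesis using Q by simp
  next
    case False
    define F where "F = (\<lambda>J. ?e -` J) ` ?L"
    have ce: "continuous_on UNIV ?e" by (intro continuous_intros)
    have im: "?e ` (?e -` J) = J" if "J \<in> ?L" for J
      using that surj unfolding local_max_set_def by blast
    have inj: "inj_on (\<lambda>J. ?e -` J) ?L" by (rule inj_onI) (metis im)
    have "finite F \<and> 2 * card F \<le> card Q"
    proof (rule card_plateau_max_le[OF _ _ Q(1) coverl coverr mono])
      show "disjoint F"
      proof (rule disjointI)
        fix A B assume "A \<in> F" "B \<in> F" "A \<noteq> B"
        then obtain J J' where "J \<in> ?L" "J' \<in> ?L" "A = ?e -` J" "B = ?e -` J'" "J \<noteq> J'"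
          unfolding F_def by blast
        then show "A \<inter> B = {}" using eq by blast
      qed
      fix T assume "T \<in> F"
      then obtain J where J: "local_max_set f p J" and T: "T = ?e -` J" unfolding F_def by blast
      obtain c U where J1: "J \<subseteq> S1" "J \<noteq> {}" "closed J" and c: "\<forall>z\<in>J. f z \<bullet> p = c"
        and U: "open U" "J \<subseteq> U" "\<forall>z\<in>(U \<inter> S1) - J. f z \<bullet> p < c"
        using J unfolding local_max_set_def by blast
      have "closed T" unfolding T using closed_vimage[OF J1(3) ce] .
      moreover have "T \<noteq> {}" using J1 im J T by blast
      moreover have "T \<noteq> UNIV"
      proof
        assume "T = UNIV"
        then have "S1 \<subseteq> J" using surj unfolding T by blast
        then show False using False J J1 by auto
      qed
      moreover have "x + 1 \<in> T \<longleftrightarrow> x \<in> T" for x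
      proof -
        have "?e (x + 1) = ?e x" by (simp add: distrib_left flip: cis_mult)
        then show ?thesis by (simp add: T)
      qed
      moreover have "open (?e -` U)" using open_vimage[OF U(1) ce] .
      moreover have "?e x \<in> S1" for x by simp
      ultimately show "plateau_max (\<lambda>s. f (?e s) \<bullet> p) T"
        unfolding plateau_max_def using U c
        by (intro conjI allI exI[of _ c] exI[of _ "?e -` U"]) (auto simp: T)
    qed
    then show ?thesis using inj unfolding F_def by (simp add: card_image finite_image_iff)
  qed
  then have "card ?L \<le> card Q div 2" "finite ?L" by auto
  then show ?thesis unfolding br_def enat_card_def by simp
qed

section \<open>Great circle arcs\<close>

text \<open>A nonzero remainder of \<open>x\<close> after projecting to \<open>e1\<close> and
  \<open>e2\<close> would be a fourth vector orthogonal to \<open>u\<close>, \<open>e1\<close>,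
  \<open>e2\<close> in dimension 3.\<close>

lemma plane_orthonormal_basis:
  fixes u e1 :: "real^3"
  assumes "u \<noteq> 0" "norm e1 = 1" "e1 \<bullet> u = 0"
  obtains e2 where "norm e2 = 1" "e1 \<bullet> e2 = 0" "\<And>x. x \<bullet> u = 0 \<Longrightarrow> x = (x \<bullet> e1) *\<^sub>R e1 + (x \<bullet> e2) *\<^sub>R e2"
proof -
  have "dim {u, e1} \<le> card {u, e1}" by (rule dim_le_card) (auto intro: span_base)
  also have "\<dots> < DIM(real^3)" by (simp add: card_insert_if)
  finally obtain y where y: "y \<noteq> 0" "\<And>z. z \<in> span {u, e1} \<Longrightarrow> orthogonal y z"
    using orthogonal_to_subspace_exists by blast
  have yu: "y \<bullet> u = 0" "y \<bullet> e1 = 0" using y(2)[of u] y(2)[of e1] by (auto simp: orthogonal_def span_base)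
  define e2 where "e2 = sgn y"
  have e2: "norm e2 = 1" "e2 \<bullet> u = 0" "e2 \<bullet> e1 = 0"
    using y(1) yu by (auto simp: e2_def norm_sgn sgn_div_norm)
  have n: "e1 \<bullet> e1 = 1" "e2 \<bullet> e2 = 1" using assms e2 by (auto simp: dot_square_norm)
  show ?thesis
  proof (rule that[of e2])
    show "norm e2 = 1" "e1 \<bullet> e2 = 0" using e2 by (auto simp: inner_commute)
    fix x :: "real^3" assume x: "x \<bullet> u = 0"
    define w where "w = x - (x \<bullet> e1) *\<^sub>R e1 - (x \<bullet> e2) *\<^sub>R e2"
    have w: "w \<bullet> u = 0" "w \<bullet> e1 = 0" "w \<bullet> e2 = 0"
      using x n assms e2 by (auto simp: w_def inner_diff_left inner_commute[of e1 e2])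
    have "w = 0"
    proof (rule ccontr)
      assume "w \<noteq> 0"
      have nz: "e1 \<noteq> 0" "e2 \<noteq> 0" using n by auto
      let ?S = "{u, e1, e2, w}"
      have d: "u \<noteq> e1" "u \<noteq> e2" "u \<noteq> w" "e1 \<noteq> e2" "e1 \<noteq> w" "e2 \<noteq> w"
        using assms e2 w nz \<open>w \<noteq> 0\<close> by (auto simp: inner_commute)
      have "pairwise orthogonal ?S"
        unfolding pairwise_def orthogonal_def using assms e2 w by (auto simp: inner_commute)
      then have "independent ?S" using nz assms \<open>w \<noteq> 0\<close> by (intro pairwise_orthogonal_independent) auto
      then have "card ?S \<le> 3" using independent_bound[of ?S] by simp
      then show False using d by simp
    qed
    then show "x = (x \<bullet> e1) *\<^sub>R e1 + (x \<bullet> e2) *\<^sub>R e2" unfolding w_def by (simp add: algebra_simps)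
  qed
qed

text \<open>In a complex coordinate on the plane of the circle, a continuous logarithm over the
  interval gives the angle. Injectivity of the arc makes the angle injective, hence strictly
  monotone, and keeps it from gaining a full turn, since the starting point would be
  revisited.\<close>

lemma great_circle_arc_angle_lift:
  fixes \<gamma> :: "real \<Rightarrow> real^3"
  assumes ab: "a < b" and \<gamma>: "continuous_on {a..b} \<gamma>" "inj_on \<gamma> {a..b}" "\<And>s. s \<in> {a..b} \<Longrightarrow> norm (\<gamma> s) = 1"
    and u: "u \<noteq> 0" "\<And>s. s \<in> {a..b} \<Longrightarrow> \<gamma> s \<bullet> u = 0"
  obtains e1 e2 \<theta> where "norm e1 = 1" "norm e2 = 1" "e1 \<bullet> e2 = 0" "continuous_on {a..b} \<theta>"
    "\<theta> b < \<theta> a + 2 * pi" "strict_mono_on {a..b} \<theta>"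
    "\<And>s. s \<in> {a..b} \<Longrightarrow> \<gamma> s = cos (\<theta> s) *\<^sub>R e1 + sin (\<theta> s) *\<^sub>R e2"
proof -
  note outer = that
  have e1: "norm (\<gamma> a) = 1" "\<gamma> a \<bullet> u = 0" using \<gamma> u ab by auto
  obtain e2 where e2: "norm e2 = 1" "\<gamma> a \<bullet> e2 = 0"
    and dec: "\<And>x. x \<bullet> u = 0 \<Longrightarrow> x = (x \<bullet> \<gamma> a) *\<^sub>R \<gamma> a + (x \<bullet> e2) *\<^sub>R e2"
    using plane_orthonormal_basis[OF u(1) e1] by blast
  define e1 where "e1 = \<gamma> a"
  note e1 = e1(1)[folded e1_def] and e2 = e2[folded e1_def] and dec = dec[folded e1_def]
  have nrm: "norm (x *\<^sub>R e1 + y *\<^sub>R e2) = sqrt (x\<^sup>2 + y\<^sup>2)" for x y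
    using e1 e2 by (simp add: norm_eq_sqrt_inner inner_add_left inner_add_right inner_commute[of e2 e1] power2_eq_square)
  define z where "z = (\<lambda>s. Complex (\<gamma> s \<bullet> e1) (\<gamma> s \<bullet> e2))"
  have zn: "cmod (z s) = 1" if "s \<in> {a..b}" for s
    using dec[of "\<gamma> s"] u(2)[OF that] \<gamma>(3)[OF that] nrm[of "\<gamma> s \<bullet> e1" "\<gamma> s \<bullet> e2"]
    by (simp add: z_def complex_norm)
  have "continuous_on {a..b} z" unfolding z_def Complex_eq by (intro continuous_intros \<gamma>)
  moreover have "z s \<noteq> 0" if "s \<in> {a..b}" for s using zn[OF that] by auto
  moreover have "contractible {a..b}" by (simp add: convex_imp_contractible)
  ultimately obtain g where g: "continuous_on {a..b} g" "\<And>s. s \<in> {a..b} \<Longrightarrow> z s = exp (g s)"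
    using continuous_logarithm_on_contractible[of "{a..b}" z] by metis
  define \<theta> where "\<theta> = (\<lambda>s. Im (g s))"
  have z\<theta>: "z s = cis (\<theta> s)" if "s \<in> {a..b}" for s
  proof -
    have "exp (Re (g s)) = 1" using zn[OF that] g(2)[OF that] by simp
    then show ?thesis using g(2)[OF that] by (simp add: exp_eq_polar \<theta>_def)
  qed
  have rep: "\<gamma> s = cos (\<theta> s) *\<^sub>R e1 + sin (\<theta> s) *\<^sub>R e2" if "s \<in> {a..b}" for s
  proof -
    have "\<gamma> s \<bullet> e1 = cos (\<theta> s)" "\<gamma> s \<bullet> e2 = sin (\<theta> s)"
      using z\<theta>[OF that] by (auto simp: z_def complex_eq_iff)
    then show ?thesis using dec[of "\<gamma> s"] u(2)[OF that] by simp
  qed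
  have c\<theta>: "continuous_on {a..b} \<theta>" unfolding \<theta>_def by (intro continuous_intros g)
  have inj: "inj_on \<theta> {a..b}"
    using \<gamma>(2) rep by (auto simp: inj_on_def)
  have main: thesis if sm: "strict_mono_on {a..b} \<eta>" and c: "continuous_on {a..b} \<eta>" and en: "norm e = 1" "e1 \<bullet> e = 0"
    and r: "\<And>s. s \<in> {a..b} \<Longrightarrow> \<gamma> s = cos (\<eta> s) *\<^sub>R e1 + sin (\<eta> s) *\<^sub>R e" for \<eta> e
  proof (rule outer[OF e1 en c _ sm])
    show "\<eta> b < \<eta> a + 2 * pi"
    proof (rule ccontr)
      assume "\<not> ?thesis"
      then obtain s where s: "s \<in> {a..b}" "\<eta> s = \<eta> a + 2 * pi"
        using IVT'[of \<eta> a "\<eta> a + 2 * pi" b] ab c by auto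
      then have "\<gamma> s = \<gamma> a" using r[of s] r[of a] ab by simp
      then have "s = a" using \<gamma>(2) s ab by (auto simp: inj_on_def)
      then show False using s by simp
    qed
  qed (rule r)
  have "strict_mono_on {a..b} \<theta> \<or> strict_antimono_on {a..b} \<theta>"
    using injective_eq_monotone_map[of "{a..b}" \<theta>] c\<theta> inj is_interval_cc by blast
  then show thesis
  proof
    assume "strict_mono_on {a..b} \<theta>"
    then show thesis using main[OF _ c\<theta> e2 rep] by blast
  next
    assume "strict_antimono_on {a..b} \<theta>"
    \<comment> \<open>A decreasing angle becomes increasing by reversing the orientation of the
      plane: negate both the angle and the second basis vector.\<close>
    then have "strict_mono_on {a..b} (\<lambda>s. - \<theta> s)" by (auto simp: monotone_on_def)
    then show thesis
      by (rule main[where e = "- e2"]) (use c\<theta> e2 rep in \<open>auto intro: continuous_intros\<close>)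
  qed
qed

text \<open>Rotating the frame puts the middle of the angular range at \<pi>. Then the direction of
  \<open>e1\<close>, at angle 0, is missed by the arc: it can serve as the axis direction in the
  parabola argument.\<close>

lemma great_circle_arc_angles:
  fixes \<gamma> :: "real \<Rightarrow> real^3"
  assumes ab: "a < b" and \<gamma>: "continuous_on {a..b} \<gamma>" "inj_on \<gamma> {a..b}" "\<And>s. s \<in> {a..b} \<Longrightarrow> norm (\<gamma> s) = 1"
    and u: "u \<noteq> 0" "\<And>s. s \<in> {a..b} \<Longrightarrow> \<gamma> s \<bullet> u = 0"
  obtains e1 e2 \<theta> where "norm e1 = 1" "norm e2 = 1" "e1 \<bullet> e2 = 0" "continuous_on {a..b} \<theta>"
    "0 < \<theta> a" "\<theta> b < 2 * pi" "strict_mono_on {a..b} \<theta>"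
    "\<And>s. s \<in> {a..b} \<Longrightarrow> \<gamma> s = cos (\<theta> s) *\<^sub>R e1 + sin (\<theta> s) *\<^sub>R e2"
proof -
  obtain e1 e2 \<theta> where e: "norm e1 = 1" "norm e2 = 1" "e1 \<bullet> e2 = 0" and c: "continuous_on {a..b} \<theta>"
    and r: "\<theta> b < \<theta> a + 2 * pi" and sm: "strict_mono_on {a..b} \<theta>"
    and rep: "\<And>s. s \<in> {a..b} \<Longrightarrow> \<gamma> s = cos (\<theta> s) *\<^sub>R e1 + sin (\<theta> s) *\<^sub>R e2"
    using great_circle_arc_angle_lift[OF assms] by blast
  define m where "m = (\<theta> a + \<theta> b) / 2 - pi"
  have n: "e1 \<bullet> e1 = 1" "e2 \<bullet> e2 = 1" "e2 \<bullet> e1 = 0" using e by (auto simp: dot_square_norm inner_commute)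
  have nrm: "norm (x *\<^sub>R e1 + y *\<^sub>R e2) = sqrt (x\<^sup>2 + y\<^sup>2)" for x y
    using n e by (simp add: norm_eq_sqrt_inner inner_add_left inner_add_right power2_eq_square)
  show ?thesis
  proof (rule that[of "cos m *\<^sub>R e1 + sin m *\<^sub>R e2" "(- sin m) *\<^sub>R e1 + cos m *\<^sub>R e2" "\<lambda>s. \<theta> s - m"])
    show "norm (cos m *\<^sub>R e1 + sin m *\<^sub>R e2) = 1" "norm ((- sin m) *\<^sub>R e1 + cos m *\<^sub>R e2) = 1"
      unfolding nrm by simp_all
    show "(cos m *\<^sub>R e1 + sin m *\<^sub>R e2) \<bullet> ((- sin m) *\<^sub>R e1 + cos m *\<^sub>R e2) = 0"
      using n e by (simp add: inner_add_left inner_add_right inner_diff_left inner_diff_right)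
    show "continuous_on {a..b} (\<lambda>s. \<theta> s - m)" by (intro continuous_intros c)
    show "0 < \<theta> a - m" "\<theta> b - m < 2 * pi" unfolding m_def using r by (simp_all add: field_simps)
    show "strict_mono_on {a..b} (\<lambda>s. \<theta> s - m)" using sm by (auto simp: monotone_on_def)
    fix s assume "s \<in> {a..b}"
    then have "\<gamma> s = cos ((\<theta> s - m) + m) *\<^sub>R e1 + sin ((\<theta> s - m) + m) *\<^sub>R e2" using rep by simp
    also have "\<dots> = cos (\<theta> s - m) *\<^sub>R (cos m *\<^sub>R e1 + sin m *\<^sub>R e2) + sin (\<theta> s - m) *\<^sub>R ((- sin m) *\<^sub>R e1 + cos m *\<^sub>R e2)"
      unfolding cos_add sin_add by (simp add: algebra_simps)
    finally show "\<gamma> s = cos (\<theta> s - m) *\<^sub>R (cos m *\<^sub>R e1 + sin m *\<^sub>R e2) + sin (\<theta> s - m) *\<^sub>R ((- sin m) *\<^sub>R e1 + cos m *\<^sub>R e2)" .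
  qed
qed

text \<open>Two independent common vectors would already span the plane containing each set, making
  the two spans equal. So all common points are a single unit vector or its negative.\<close>

lemma finite_sphere_Int_planes:
  fixes A B :: "(real^3) set"
  assumes A: "u \<noteq> 0" "\<And>x. x \<in> A \<Longrightarrow> x \<bullet> u = 0" and B: "v \<noteq> 0" "\<And>x. x \<in> B \<Longrightarrow> x \<bullet> v = 0"
    and "span A \<noteq> span B" and S: "A \<subseteq> sphere 0 1"
  shows "finite (A \<inter> B)"
proof (cases "A \<inter> B = {}")
  case False
  then obtain x where x: "x \<in> A" "x \<in> B" by blast
  have eq: "span {x, y} = span C"
    if "independent {x, y}" "x \<noteq> y" "x \<in> C" "y \<in> C" "w \<noteq> 0" "\<And>x. x \<in> C \<Longrightarrow> x \<bullet> w = 0" for y w :: "real^3" and C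
  proof (rule subspace_dim_equal)
    show "span {x, y} \<subseteq> span C" using that by (intro span_mono) auto
    have "C \<subseteq> {z. w \<bullet> z = 0}" using that by (auto simp: inner_commute)
    then have "dim C \<le> dim {z. w \<bullet> z = 0}" by (rule dim_subset)
    also have "\<dots> = 2" using dim_hyperplane[OF that(5)] by simp
    also have "\<dots> = dim (span {x, y})" using that by (simp add: dim_eq_card_independent)
    finally show "dim (span C) \<le> dim (span {x, y})" by simp
  qed auto
  have "y = x \<or> y = - x" if y: "y \<in> A \<inter> B" for y
  proof (rule ccontr)
    assume ne: "\<not> ?thesis"
    have n: "norm x = 1" "norm y = 1" using S x y by auto
    have "independent {x, y}"
    proof
      assume "dependent {x, y}"
      moreover have "y \<noteq> 0" using n by auto
      then have "independent {y}" by simp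
      ultimately have "x \<in> span {y}" using independent_insertI by blast
      then obtain k where k: "x = k *\<^sub>R y" by (auto simp: span_singleton)
      then have "\<bar>k\<bar> = 1" using n by simp
      then show False using k ne by (auto simp: abs_if split: if_splits)
    qed
    then have "span A = span B" using eq[of y A u] eq[of y B v] A B x y ne by auto
    then show False using assms by blast
  qed
  then have "A \<inter> B \<subseteq> {x, - x}" by blast
  then show ?thesis by (rule finite_subset) simp
qed simp

lemma polynomial_interpolation:
  fixes f :: "'a::field \<Rightarrow> 'a"
  assumes "finite A"
  shows "\<exists>p. \<forall>x\<in>A. poly p x = f x"
  using assms
proof induction
  case (insert a A)
  then obtain p where p: "\<forall>x\<in>A. poly p x = f x" by blast
  define q where "q = (\<Prod>x\<in>A. [:- x, 1:])"
  have q0: "poly q x = 0" if "x \<in> A" for x using that insert(1) by (auto simp: q_def poly_prod)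
  have qa: "poly q a \<noteq> 0" using insert(1,2) by (auto simp: q_def poly_prod)
  show ?case
    by (rule exI[of _ "p + smult ((f a - poly p a) / poly q a) q"]) (use p q0 qa in auto)
qed simp

section \<open>Spherical stick curves\<close>

locale stick_curve =
  fixes n :: nat and \<gamma> :: "real \<Rightarrow> real^3" and t :: "nat \<Rightarrow> real"
  assumes ssc: "spherical_stick_curve n \<gamma> t"
begin

lemma n_pos: "1 \<le> n" and t_0: "t 0 = 0" and t_n: "t n = 1" and t_less: "i < n \<Longrightarrow> t i < t (Suc i)"
  and cont: "continuous_on {0..1} \<gamma>"
  and norm_curve: "s \<in> {0..1} \<Longrightarrow> norm (\<gamma> s) = 1"
  and inj_piece: "i < n \<Longrightarrow> inj_on \<gamma> {t i..t (Suc i)}"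
  using ssc unfolding spherical_stick_curve_def by auto

lemma piece_normal: "i < n \<Longrightarrow> \<exists>u. u \<noteq> 0 \<and> (\<forall>x\<in>arc_piece \<gamma> t i. x \<bullet> u = 0)"
  using ssc unfolding spherical_stick_curve_def by blast

lemma double_point:
  assumes "s \<in> {0..<1}" "s' \<in> {0..<1}" "s \<noteq> s'" "\<gamma> s = \<gamma> s'"
    and "i < n" "j < n" "s \<in> {t i..t (Suc i)}" "s' \<in> {t j..t (Suc j)}"
  shows "span (arc_piece \<gamma> t i) \<noteq> span (arc_piece \<gamma> t j)"
  using ssc assms unfolding spherical_stick_curve_def by blast

lemma t_mono: "i \<le> j \<Longrightarrow> j \<le> n \<Longrightarrow> t i \<le> t j"
proof (induction j rule: dec_induct)
  case (step j)
  then show ?case using t_less[of j] by simp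
qed simp

lemma piece_subset: "i < n \<Longrightarrow> {t i..t (Suc i)} \<subseteq> {0..1}"
  using t_mono[of 0 i] t_mono[of "Suc i" n] t_0 t_n by auto

lemma pieces_meet_at_vertex:
  assumes "i < n" "j < n" "i \<noteq> j" "s \<in> {t i..t (Suc i)}" "s \<in> {t j..t (Suc j)}"
  shows "\<exists>k\<le>n. s = t k"
proof -
  have *: "\<exists>k\<le>n. s = t k" if "i < j" "j < n" "s \<in> {t i..t (Suc i)}" "s \<in> {t j..t (Suc j)}" for i j
    using t_mono[of "Suc i" j] that by (intro exI[of _ j]) auto
  then show ?thesis using assms by (metis linorder_neqE_nat)
qed

text \<open>Two arcs may lie on the same great circle, and transversality is available only at
  genuine double points. If every common point is a vertex image, finiteness is clear; otherwise one
  common point away from the vertices makes the spans of the arcs differ.\<close>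

lemma finite_arc_Int:
  assumes "i < n" "j < n" "i \<noteq> j"
  shows "finite (arc_piece \<gamma> t i \<inter> arc_piece \<gamma> t j)"
proof (cases "arc_piece \<gamma> t i \<inter> arc_piece \<gamma> t j \<subseteq> \<gamma> ` t ` {..n}")
  case True
  then show ?thesis by (rule finite_subset) simp
next
  case False
  then obtain s s' where s: "s \<in> {t i..t (Suc i)}" "s' \<in> {t j..t (Suc j)}" "\<gamma> s = \<gamma> s'" "\<gamma> s \<notin> \<gamma> ` t ` {..n}"
    unfolding arc_piece_def by blast
  have nv: "s \<noteq> t k" "s' \<noteq> t k" if "k \<le> n" for k using s(3,4) that by (metis atMost_iff imageI)+
  have "s \<noteq> s'" using pieces_meet_at_vertex[OF assms] s nv by blast
  moreover have "s \<in> {0..1}" "s' \<in> {0..1}" using piece_subset assms s by blast+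
  then have "s \<in> {0..<1}" "s' \<in> {0..<1}" using nv[of n] t_n by (auto simp: order_le_less)
  ultimately have "span (arc_piece \<gamma> t i) \<noteq> span (arc_piece \<gamma> t j)" using double_point assms s by blast
  moreover obtain u where "u \<noteq> 0" "\<forall>x\<in>arc_piece \<gamma> t i. x \<bullet> u = 0" using piece_normal assms by blast
  moreover obtain v where "v \<noteq> 0" "\<forall>x\<in>arc_piece \<gamma> t j. x \<bullet> v = 0" using piece_normal assms by blast
  moreover have "arc_piece \<gamma> t i \<subseteq> sphere 0 1"
    using norm_curve piece_subset[OF assms(1)] unfolding arc_piece_def by (force simp: subset_iff)
  ultimately show ?thesis using finite_sphere_Int_planes by blast
qed

lemma exists_angles:
  assumes "i < n"
  shows "\<exists>e1 e2 \<theta>. norm e1 = 1 \<and> norm e2 = 1 \<and> e1 \<bullet> e2 = 0 \<and> continuous_on {t i..t (Suc i)} \<theta> \<and>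
    0 < \<theta> (t i) \<and> \<theta> (t (Suc i)) < 2 * pi \<and> strict_mono_on {t i..t (Suc i)} \<theta> \<and>
    (\<forall>s\<in>{t i..t (Suc i)}. \<gamma> s = cos (\<theta> s) *\<^sub>R e1 + sin (\<theta> s) *\<^sub>R e2)"
proof -
  obtain u where u: "u \<noteq> 0" "\<forall>x\<in>arc_piece \<gamma> t i. x \<bullet> u = 0" using piece_normal assms by blast
  have "continuous_on {t i..t (Suc i)} \<gamma>" using cont piece_subset[OF assms] by (rule continuous_on_subset)
  then show ?thesis
    using great_circle_arc_angles[OF t_less[OF assms] _ inj_piece[OF assms] _ u(1)]
      u(2) norm_curve piece_subset[OF assms] unfolding arc_piece_def by (smt (verit) image_eqI subsetD)
qed

text \<open>Prescribing \<open>ln r\<close> at the crossings and vertices makes the correction on each arc vanish where arcs meet,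
  so the corrections glue to a continuous function on the curve.\<close>
lemma exists_correction:
  fixes \<theta> :: "nat \<Rightarrow> real \<Rightarrow> real" and \<rho> :: "real \<Rightarrow> real"
  assumes \<theta>c: "\<And>i. i < n \<Longrightarrow> continuous_on {t i..t (Suc i)} (\<theta> i)"
    and \<theta>m: "\<And>i. i < n \<Longrightarrow> strict_mono_on {t i..t (Suc i)} (\<theta> i)"
    and \<rho>: "continuous_on {0..1} \<rho>"
  obtains \<kappa> :: "nat \<Rightarrow> real poly" and c :: "real^3 \<Rightarrow> real"
  where "continuous_on UNIV c"
    "\<And>i s. i < n \<Longrightarrow> s \<in> {t i..t (Suc i)} \<Longrightarrow> c (\<gamma> s) = poly (\<kappa> i) (\<theta> i s) - \<rho> s"
proof -
  let ?I = "\<lambda>i. {t i..t (Suc i)}" and ?A = "\<lambda>i. arc_piece \<gamma> t i"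
  \<comment> \<open>Parameters on arc \<open>i\<close> whose image lies on another arc: the
    crossings with other arcs and the vertices shared with the neighbouring arcs alike.\<close>
  define X where "X = (\<lambda>i. {s \<in> ?I i. \<exists>j<n. j \<noteq> i \<and> \<gamma> s \<in> ?A j})"
  have "\<exists>p. \<forall>s\<in>X i. poly p (\<theta> i s) = \<rho> s" if i: "i < n" for i
  proof -
    have "\<gamma> ` X i \<subseteq> (\<Union>j\<in>{..<n} - {i}. ?A i \<inter> ?A j)" unfolding X_def arc_piece_def by blast
    moreover have "finite \<dots>" using finite_arc_Int i by blast
    ultimately have "finite (\<gamma> ` X i)" by (rule finite_subset)
    moreover have "inj_on \<gamma> (X i)" using inj_piece[OF i] by (rule inj_on_subset) (auto simp: X_def)
    ultimately have "finite (\<theta> i ` X i)" using finite_imageD by blast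
    then obtain p where p: "\<forall>x\<in>\<theta> i ` X i. poly p x = \<rho> (inv_into (?I i) (\<theta> i) x)"
      using polynomial_interpolation[of "\<theta> i ` X i" "\<lambda>x. \<rho> (inv_into (?I i) (\<theta> i) x)"] by blast
    have "inv_into (?I i) (\<theta> i) (\<theta> i s) = s" if "s \<in> X i" for s
      using strict_mono_on_imp_inj_on[OF \<theta>m[OF i]] that by (intro inv_into_f_f) (auto simp: X_def)
    then show ?thesis using p by (intro exI[of _ p]) auto
  qed
  then obtain \<kappa> where \<kappa>: "\<And>i s. i < n \<Longrightarrow> s \<in> X i \<Longrightarrow> poly (\<kappa> i) (\<theta> i s) = \<rho> s" by metis
  define h where "h = (\<lambda>i s. poly (\<kappa> i) (\<theta> i s) - \<rho> s)"
  define h' where "h' = (\<lambda>i \<omega>. h i (inv_into (?I i) \<gamma> \<omega>))"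
  have inv: "inv_into (?I i) \<gamma> (\<gamma> s) = s" if "i < n" "s \<in> ?I i" for i s
    using inv_into_f_f[OF inj_piece] that by blast
  have h'0: "h' i \<omega> = 0" if "i < n" "j < n" "i \<noteq> j" "\<omega> \<in> ?A i" "\<omega> \<in> ?A j" for i j \<omega>
  proof -
    from that(4) obtain s where s: "s \<in> ?I i" "\<omega> = \<gamma> s" unfolding arc_piece_def by blast
    then have "s \<in> X i" using that unfolding X_def by blast
    then show ?thesis using \<kappa> that(1) inv[OF that(1) s(1)] s by (simp add: h'_def h_def)
  qed
  have arc_cont: "continuous_on (?I i) \<gamma>" if "i < n" for i
    using cont piece_subset[OF that] by (rule continuous_on_subset)
  have h'c: "continuous_on (?A i) (h' i)" if i: "i < n" for i
  proof -
    have 1: "continuous_on (?A i) (inv_into (?I i) \<gamma>)"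
      unfolding arc_piece_def by (rule continuous_on_inv[OF arc_cont[OF i]]) (use inv[OF i] in auto)
    have 2: "continuous_on (?I i) (h i)"
      unfolding h_def using \<rho> piece_subset[OF i]
      by (intro continuous_intros \<theta>c i) (auto elim: continuous_on_subset)
    show ?thesis
      unfolding h'_def by (rule continuous_on_compose2[OF 2 1]) (use inv[OF i] in \<open>auto simp: arc_piece_def\<close>)
  qed
  \<comment> \<open>The choice of arc is immaterial: at a point on several arcs all the local
    corrections are 0.\<close>
  define c0 where "c0 = (\<lambda>\<omega>. h' (LEAST i. i < n \<and> \<omega> \<in> ?A i) \<omega>)"
  have c0: "c0 \<omega> = h' i \<omega>" if "i < n" "\<omega> \<in> ?A i" for i \<omega>
  proof -
    let ?k = "LEAST i. i < n \<and> \<omega> \<in> ?A i"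
    have k: "?k < n \<and> \<omega> \<in> ?A ?k" using that by (intro LeastI[of "\<lambda>i. i < n \<and> \<omega> \<in> ?A i" i]) auto
    show ?thesis
    proof (cases "?k = i")
      case True then show ?thesis by (simp add: c0_def)
    next
      case False
      then show ?thesis using h'0[of ?k i \<omega>] h'0[of i ?k \<omega>] k that by (simp add: c0_def)
    qed
  qed
  have closedA: "closed (?A i)" if "i < n" for i
    unfolding arc_piece_def using compact_continuous_image[OF arc_cont[OF that]] compact_imp_closed by blast
  have "continuous_on (\<Union>i\<in>{..<n}. ?A i) c0"
  proof (rule continuous_on_closed_Union)
    fix i assume "i \<in> {..<n}"
    then have i: "i < n" by simp
    show "closed (?A i)" using closedA i .
    show "continuous_on (?A i) c0" using h'c[OF i] c0[OF i] by (simp cong: continuous_on_cong)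
  qed simp
  moreover have "closed (\<Union>i\<in>{..<n}. ?A i)" using closedA by (intro closed_UN) auto
  \<comment> \<open>The radial map needs a correction in every direction, not only along the curve,
    so the one on the closed union of arcs is extended by Tietze.\<close>
  ultimately obtain c where c: "continuous_on UNIV c" "\<And>\<omega>. \<omega> \<in> (\<Union>i\<in>{..<n}. ?A i) \<Longrightarrow> c \<omega> = c0 \<omega>"
    using Tietze_unbounded[of "\<Union>i\<in>{..<n}. ?A i" c0 UNIV] by auto
  have "c (\<gamma> s) = h i s" if "i < n" "s \<in> ?I i" for i s
  proof -
    have "\<gamma> s \<in> ?A i" using that by (auto simp: arc_piece_def)
    moreover from this have "c (\<gamma> s) = c0 (\<gamma> s)" using c(2) that by blast
    ultimately show ?thesis using c0[OF that(1)] inv[OF that] by (simp add: h'_def)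
  qed
  then show ?thesis using that[OF c(1), of \<kappa>] by (simp add: h_def)
qed

text \<open>The order of the choices matters. The polynomials \<kappa> depend only on the given
  curve; \<beta> is then chosen so that the unperturbed first arc turns by less than \<pi>; \<delta>
  comes last, so small that the finitely many strict inequalities on turning and convexity persist.
  No choice depends on the direction \<open>p\<close>.\<close>

lemma exists_low_bridge_representative:
  assumes f: "f \<in> knot_type K" and r: "\<And>s. s \<in> {0..1} \<Longrightarrow> r s > 0 \<and> f (cis (2 * pi * s)) = r s *\<^sub>R \<gamma> s"
  shows "\<exists>f'\<in>knot_type K. \<forall>p. br f' p \<le> enat ((3 * n - 1) div 2)"
proof -
  let ?I = "\<lambda>i. {t i..t (Suc i)}"
  have "\<forall>i. \<exists>e1 e2 \<theta>. i < n \<longrightarrow> (norm e1 = 1 \<and> norm e2 = 1 \<and> e1 \<bullet> e2 = 0 \<and> continuous_on (?I i) \<theta> \<and>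
    0 < \<theta> (t i) \<and> \<theta> (t (Suc i)) < 2 * pi \<and> strict_mono_on (?I i) \<theta> \<and>
    (\<forall>s\<in>?I i. \<gamma> s = cos (\<theta> s) *\<^sub>R e1 + sin (\<theta> s) *\<^sub>R e2))"
    using exists_angles by blast
  then obtain e1 e2 \<theta> where ex: "\<forall>i. i < n \<longrightarrow> (norm (e1 i) = 1 \<and> norm (e2 i) = 1 \<and> e1 i \<bullet> e2 i = 0 \<and> continuous_on (?I i) (\<theta> i) \<and>
    0 < \<theta> i (t i) \<and> \<theta> i (t (Suc i)) < 2 * pi \<and> strict_mono_on (?I i) (\<theta> i) \<and>
    (\<forall>s\<in>?I i. \<gamma> s = cos (\<theta> i s) *\<^sub>R e1 i + sin (\<theta> i s) *\<^sub>R e2 i))"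
    by metis
  have e: "norm (e1 i) = 1" "norm (e2 i) = 1" "e1 i \<bullet> e2 i = 0" if "i < n" for i using ex that by auto
  have \<theta>c: "continuous_on (?I i) (\<theta> i)" and \<theta>m: "strict_mono_on (?I i) (\<theta> i)"
    and \<theta>r: "0 < \<theta> i (t i)" "\<theta> i (t (Suc i)) < 2 * pi" if "i < n" for i using ex that by auto
  have \<gamma>: "\<gamma> s = cos (\<theta> i s) *\<^sub>R e1 i + sin (\<theta> i s) *\<^sub>R e2 i" if "i < n" "s \<in> ?I i" for i s
    using ex that by blast
  have \<theta>le: "\<theta> i (t i) < \<theta> i (t (Suc i))" if "i < n" for i
    using strict_mono_onD[OF \<theta>m[OF that]] t_less[OF that] by auto
  have "knot f" using f by (simp add: knot_type_def)
  then have fc: "continuous_on S1 f" by (simp add: knot_def)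
  have "continuous_on {0..1} (\<lambda>s::real. f (cis (2 * pi * s)))"
    by (rule continuous_on_compose2[OF fc]) (auto intro!: continuous_intros)
  then have "continuous_on {0..1} (\<lambda>s. norm (f (cis (2 * pi * s))))" by (rule continuous_on_norm)
  then have rc: "continuous_on {0..1} r"
  proof (rule continuous_on_eq)
    show "norm (f (cis (2 * pi * s))) = r s" if "s \<in> {0..1}" for s
      using r[OF that] norm_curve[OF that] by simp
  qed
  have lrc: "continuous_on {0..1} (\<lambda>s. ln (r s))" by (intro continuous_intros rc) (use r in fastforce)
  obtain \<kappa> c where cc: "continuous_on UNIV c"
    and c: "\<And>i s. i < n \<Longrightarrow> s \<in> ?I i \<Longrightarrow> c (\<gamma> s) = poly (\<kappa> i) (\<theta> i s) - ln (r s)"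
    by (rule exists_correction[OF \<theta>c \<theta>m lrc], assumption, assumption, rule that, assumption, blast)
  have n0: "0 < n" using n_pos by simp
  have "\<forall>\<^sub>F \<beta> in at_left (1::real). tangent_angle (- \<beta>) 0 (\<kappa> 0) 0 (\<theta> 0 (t (Suc 0))) - tangent_angle (- \<beta>) 0 (\<kappa> 0) 0 (\<theta> 0 (t 0)) < pi"
    using \<theta>r[OF n0] \<theta>le[OF n0] by (intro eventually_tangent_angle_parabola) auto
  moreover have "\<forall>\<^sub>F \<beta> in at_left (1::real). \<beta> \<in> {0<..<1}" by (rule eventually_at_leftI[of 0]) auto
  ultimately have "\<exists>\<beta>. tangent_angle (- \<beta>) 0 (\<kappa> 0) 0 (\<theta> 0 (t (Suc 0))) - tangent_angle (- \<beta>) 0 (\<kappa> 0) 0 (\<theta> 0 (t 0)) < pi \<and> \<beta> \<in> {0<..<1}"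
    by (rule eventually_happens'[OF trivial_limit_at_left_real eventually_conj])
  then obtain \<beta> :: real where \<beta>: "0 < \<beta>" "\<beta> < 1"
    and \<beta>0: "tangent_angle (- \<beta>) 0 (\<kappa> 0) 0 (\<theta> 0 (t (Suc 0))) - tangent_angle (- \<beta>) 0 (\<kappa> 0) 0 (\<theta> 0 (t 0)) < pi"
    by auto
  \<comment> \<open>\<open>e1 0\<close> is the direction at angle 0, missed by the first arc. In the
    plane of that arc the denominator becomes \<open>1 - \<beta> * cos \<theta>\<close>, which
    approaches the parabola as \<beta> tends to 1.\<close>
  define b where "b = (- \<beta>) *\<^sub>R e1 0"
  have nb: "norm b = \<beta>" using e[OF n0] \<beta> by (simp add: b_def)
  define B1 B2 where "B1 = (\<lambda>i. b \<bullet> e1 i)" and "B2 = (\<lambda>i. b \<bullet> e2 i)"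
  have B0: "B1 0 = - \<beta>" "B2 0 = 0" using e[OF n0] by (auto simp: B1_def B2_def b_def dot_square_norm)
  have B: "(B1 i)\<^sup>2 + (B2 i)\<^sup>2 < 1" if "i < n" for i
  proof -
    have n: "e1 i \<bullet> e1 i = 1" "e2 i \<bullet> e2 i = 1" "e2 i \<bullet> e1 i = 0"
      using e[OF that] by (simp_all only: dot_square_norm inner_commute[of "e2 i"]) simp_all
    \<comment> \<open>Bessel's inequality: projecting \<open>b\<close> to the plane of an arc does
      not lengthen it, so \<beta> < 1 keeps the conics on all arcs elliptic at once.\<close>
    have "0 \<le> (b - B1 i *\<^sub>R e1 i - B2 i *\<^sub>R e2 i) \<bullet> (b - B1 i *\<^sub>R e1 i - B2 i *\<^sub>R e2 i)" by simp
    also have "\<dots> = b \<bullet> b - (B1 i)\<^sup>2 - (B2 i)\<^sup>2"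
      using n e(3)[OF that] inner_commute[of "e1 i" b] inner_commute[of "e2 i" b]
      by (simp add: inner_diff_left inner_diff_right B1_def B2_def power2_eq_square)
    finally have "(B1 i)\<^sup>2 + (B2 i)\<^sup>2 \<le> \<beta>\<^sup>2" using nb by (simp add: dot_square_norm)
    also have "\<dots> < 1" using \<beta> by (simp add: abs_square_less_1)
    finally show ?thesis .
  qed
  let ?T = "\<lambda>i \<delta>. tangent_angle (B1 i) (B2 i) (\<kappa> i) \<delta>"
  have "\<forall>\<^sub>F \<delta> in at_right 0. strict_mono_on {\<theta> i (t i)..\<theta> i (t (Suc i))} (?T i \<delta>) \<and>
      ?T i \<delta> (\<theta> i (t (Suc i))) - ?T i \<delta> (\<theta> i (t i)) < 2 * pi" if "i < n" for i
    using \<theta>r[OF that]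
    by (intro eventually_conj eventually_strict_mono_tangent_angle eventually_tangent_angle_range tangent_angle_zero_range B that) auto
  then have "\<forall>\<^sub>F \<delta> in at_right 0. \<forall>i\<in>{..<n}. strict_mono_on {\<theta> i (t i)..\<theta> i (t (Suc i))} (?T i \<delta>) \<and>
      ?T i \<delta> (\<theta> i (t (Suc i))) - ?T i \<delta> (\<theta> i (t i)) < 2 * pi"
    by (intro eventually_ball_finite) auto
  moreover have "\<forall>\<^sub>F \<delta> in at_right 0. ?T 0 \<delta> (\<theta> 0 (t (Suc 0))) - ?T 0 \<delta> (\<theta> 0 (t 0)) < pi"
    using \<beta>0 unfolding B0 by (rule eventually_tangent_angle_range)
  moreover have "\<forall>\<^sub>F \<delta>::real in at_right 0. 0 < \<delta>" by (simp add: eventually_at_right_less)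
  ultimately have "\<forall>\<^sub>F \<delta> in at_right 0. (\<forall>i\<in>{..<n}. strict_mono_on {\<theta> i (t i)..\<theta> i (t (Suc i))} (?T i \<delta>) \<and>
      ?T i \<delta> (\<theta> i (t (Suc i))) - ?T i \<delta> (\<theta> i (t i)) < 2 * pi) \<and>
      ?T 0 \<delta> (\<theta> 0 (t (Suc 0))) - ?T 0 \<delta> (\<theta> 0 (t 0)) < pi \<and> 0 < \<delta>"
    by (intro eventually_conj)
  from eventually_happens'[OF trivial_limit_at_right_real this]
  obtain \<delta> where \<delta>: "0 < \<delta>" "?T 0 \<delta> (\<theta> 0 (t (Suc 0))) - ?T 0 \<delta> (\<theta> 0 (t 0)) < pi"
    and T': "\<forall>i\<in>{..<n}. strict_mono_on {\<theta> i (t i)..\<theta> i (t (Suc i))} (?T i \<delta>) \<and>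
      ?T i \<delta> (\<theta> i (t (Suc i))) - ?T i \<delta> (\<theta> i (t i)) < 2 * pi" by (elim exE conjE) (rule that)
  have T: "strict_mono_on {\<theta> i (t i)..\<theta> i (t (Suc i))} (?T i \<delta>)"
    "?T i \<delta> (\<theta> i (t (Suc i))) - ?T i \<delta> (\<theta> i (t i)) < 2 * pi" if "i < n" for i
    using T' that by auto
  \<comment> \<open>Chosen so that along arc \<open>i\<close> the new logarithmic radius
    \<open>\<delta> * ln r + C\<close> equals \<delta> times the polynomial \<kappa> of the angle,
    minus \<open>ln (1 + b \<bullet> \<omega>)\<close>: the unknown \<open>ln r\<close> cancels
    against the correction.\<close>
  define C where "C = (\<lambda>\<omega>. \<delta> * c \<omega> - ln (1 + b \<bullet> \<omega>))"
  have pos: "0 < 1 + b \<bullet> \<omega>" if "norm \<omega> = 1" for \<omega>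
    using Cauchy_Schwarz_ineq2[of b \<omega>] that nb \<beta> by auto
  have Cc: "continuous_on (sphere 0 1) C"
    unfolding C_def by (intro continuous_intros continuous_on_subset[OF cc]) (use pos in \<open>force+\<close>)
  define f' where "f' = radial_map \<delta> C \<circ> f"
  have f': "f' \<in> knot_type K" unfolding f'_def by (rule radial_map_in_knot_type[OF f Cc \<delta>(1)])
  have val: "f' (cis (2 * pi * s)) = (exp (\<delta> * poly (\<kappa> i) (\<theta> i s)) / conic_denom (B1 i) (B2 i) (\<theta> i s)) *\<^sub>R \<gamma> s"
    if i: "i < n" and s: "s \<in> ?I i" for i s
  proof -
    have s01: "s \<in> {0..1}" using piece_subset i s by blast
    have n1: "norm (\<gamma> s) = 1" and rs: "r s > 0" using norm_curve r s01 by auto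
    have sg: "sgn (r s *\<^sub>R \<gamma> s) = \<gamma> s" using n1 rs by (simp add: sgn_div_norm)
    have U: "1 + b \<bullet> \<gamma> s = conic_denom (B1 i) (B2 i) (\<theta> i s)"
      by (simp add: \<gamma>[OF i s] conic_denom_def B1_def B2_def inner_add_right mult.commute)
    have "f' (cis (2 * pi * s)) = (r s powr \<delta> * exp (C (\<gamma> s))) *\<^sub>R \<gamma> s"
      using r[OF s01] n1 rs by (simp add: f'_def radial_map_def sg)
    also have "r s powr \<delta> * exp (C (\<gamma> s)) = exp (\<delta> * poly (\<kappa> i) (\<theta> i s)) * exp (- ln (1 + b \<bullet> \<gamma> s))"
      using rs by (simp add: powr_def C_def c[OF i s] algebra_simps flip: exp_add)
    also have "exp (- ln (1 + b \<bullet> \<gamma> s)) = 1 / (1 + b \<bullet> \<gamma> s)"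
      using pos[OF n1] by (simp add: exp_minus field_simps)
    finally show ?thesis by (simp add: U)
  qed
  have "br f' p \<le> enat ((3 * n - 1) div 2)" for p
  proof -
    let ?g = "\<lambda>s. f' (cis (2 * pi * s)) \<bullet> p"
    let ?m = "\<lambda>a b. mono_on {a..b} ?g \<or> antimono_on {a..b} ?g"
    have "\<exists>y1 y2. t i \<le> y1 \<and> y1 \<le> y2 \<and> y2 \<le> t (Suc i) \<and> (i = 0 \<longrightarrow> y2 = t (Suc i)) \<and>
       ?m (t i) y1 \<and> ?m y1 y2 \<and> ?m y2 (t (Suc i))" if i: "i < n" for i
    proof -
      have g: "?g s = exp (\<delta> * poly (\<kappa> i) (\<theta> i s)) / conic_denom (B1 i) (B2 i) (\<theta> i s) *
            ((e1 i \<bullet> p) * cos (\<theta> i s) + (e2 i \<bullet> p) * sin (\<theta> i s))" if s: "s \<in> ?I i" for s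
        unfolding val[OF i s] by (simp add: \<gamma>[OF i s] inner_add_left algebra_simps)
      obtain y1 y2 where y: "t i \<le> y1" "y1 \<le> y2" "y2 \<le> t (Suc i)"
          "?T i \<delta> (\<theta> i (t (Suc i))) - ?T i \<delta> (\<theta> i (t i)) \<le> pi \<Longrightarrow> y2 = t (Suc i)"
          "?m (t i) y1" "?m y1 y2" "?m y2 (t (Suc i))"
        using arc_height_pieces[OF less_imp_le[OF t_less[OF i]] B[OF i] \<theta>c[OF i] \<theta>m[OF i] T(1)[OF i] less_imp_le[OF T(2)[OF i]] g]
        by blast
      have "i = 0 \<longrightarrow> y2 = t (Suc i)" using y(4) \<delta>(2) by auto
      then show ?thesis using y by blast
    qed
    then obtain y1 y2 where y: "\<And>i. i < n \<Longrightarrow> t i \<le> y1 i \<and> y1 i \<le> y2 i \<and> y2 i \<le> t (Suc i) \<and> (i = 0 \<longrightarrow> y2 i = t (Suc i)) \<and>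
       ?m (t i) (y1 i) \<and> ?m (y1 i) (y2 i) \<and> ?m (y2 i) (t (Suc i))" by metis
    define \<tau> where "\<tau> = (\<lambda>i (q::nat). if q = 0 then t i else if q = 1 then y1 i else if q = 2 then y2 i else t (Suc i))"
    \<comment> \<open>Three pieces per arc, except that the last piece of arc 0 is dropped: there
      \<open>y2 0 = t 1\<close>, so it is a single point.\<close>
    define Q where "Q = {..<n} \<times> {..<3::nat} - {(0, 2)}"
    have cardQ: "card Q = 3 * n - 1" "finite Q"
      unfolding Q_def using n0 by (simp_all add: card_Diff_singleton)
    have "br f' p \<le> enat (card Q div 2)"
    proof (rule br_le_monotone_pieces[where a = "\<lambda>(i, q). \<tau> i q" and b = "\<lambda>(i, q). \<tau> i (Suc q)"])
      show "finite Q" "2 \<le> card Q" using cardQ n_pos by auto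
      show "\<exists>k\<in>Q. (case k of (i, q) \<Rightarrow> \<tau> i q) < l \<and> l \<le> (case k of (i, q) \<Rightarrow> \<tau> i (Suc q))" if l: "0 < l" "l \<le> 1" for l
      proof -
        obtain i where i: "i < n" "\<tau> i 0 < l" "l \<le> \<tau> i 3"
          using partition_left_cover[of t l n] l t_0 t_n by (auto simp: \<tau>_def)
        obtain q where q: "q < 3" "\<tau> i q < l" "l \<le> \<tau> i (Suc q)"
          using partition_left_cover[of "\<tau> i" l 3] i by auto
        \<comment> \<open>The selected piece has positive length, so it cannot be the dropped
          degenerate one.\<close>
        have "(i, q) \<in> Q" using i q y[OF i(1)] by (auto simp: Q_def \<tau>_def)
        then show ?thesis using q by (intro bexI[of _ "(i, q)"]) auto
      qed
      show "\<exists>k\<in>Q. (case k of (i, q) \<Rightarrow> \<tau> i q) \<le> l \<and> l < (case k of (i, q) \<Rightarrow> \<tau> i (Suc q))" if l: "0 \<le> l" "l < 1" for l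
      proof -
        obtain i where i: "i < n" "\<tau> i 0 \<le> l" "l < \<tau> i 3"
          using partition_right_cover[of t l n] l t_0 t_n by (auto simp: \<tau>_def)
        obtain q where q: "q < 3" "\<tau> i q \<le> l" "l < \<tau> i (Suc q)"
          using partition_right_cover[of "\<tau> i" l 3] i by auto
        have "(i, q) \<in> Q" using i q y[OF i(1)] by (auto simp: Q_def \<tau>_def)
        then show ?thesis using q by (intro bexI[of _ "(i, q)"]) auto
      qed
      fix k assume "k \<in> Q"
      then obtain i q where k: "k = (i, q)" "i < n" "q < 3" unfolding Q_def by auto
      then consider "q = 0" | "q = 1" | "q = 2" by linarith
      then show "?m (case k of (i, q) \<Rightarrow> \<tau> i q) (case k of (i, q) \<Rightarrow> \<tau> i (Suc q))"
        by cases (use y[OF k(2)] k(1) in \<open>simp_all add: \<tau>_def\<close>)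
    qed
    then show ?thesis using cardQ by simp
  qed
  then show ?thesis using f' by blast
qed

end

section \<open>From one diagram to the inequality between the invariants\<close>

lemma superbridge_le_represents_sps:
  assumes "represents_sps n K"
  shows "1 \<le> n" "superbridge K \<le> enat ((3 * n - 1) div 2)"
proof -
  obtain \<gamma> t r f where c: "spherical_stick_curve n \<gamma> t" and f: "f \<in> knot_type K"
    and r: "\<forall>s\<in>{0..1}. r s > (0::real) \<and> f (cis (2 * pi * s)) = r s *\<^sub>R \<gamma> s"
    using assms unfolding represents_sps_def by blast
  interpret stick_curve n \<gamma> t using c by unfold_locales
  obtain f' where f': "f' \<in> knot_type K" "\<And>p. br f' p \<le> enat ((3 * n - 1) div 2)"
    using exists_low_bridge_representative[OF f, of r] r by blast
  have "superbridge K \<le> (SUP p\<in>sphere 0 1. br f' p)" unfolding superbridge_def using f'(1) by (rule INF_lower)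
  also have "\<dots> \<le> enat ((3 * n - 1) div 2)" using f'(2) by (intro SUP_least)
  finally show "superbridge K \<le> enat ((3 * n - 1) div 2)" .
  show "1 \<le> n" by (rule n_pos)
qed

theorem theorem3p6:
  fixes K :: "complex \<Rightarrow> real^3"
  assumes "knot K" and "tame K" and "nontrivial K"
  shows "ereal (2/3) * ereal_of_enat (superbridge K) + ereal (1/3) \<le> ereal_of_enat (sps K)"
proof (cases "{n. represents_sps n K} = {}")
  case True
  then have "sps K = \<infinity>" unfolding sps_def by (simp add: top_enat_def)
  then show ?thesis by simp
next
  case False
  then obtain k where "enat k \<in> enat ` {n. represents_sps n K}" by blast
  \<comment> \<open>The infimum over a nonempty set of extended naturals is attained, so it is
    enough to bound the superbridge index by one minimal diagram.\<close>
  then have "sps K \<in> enat ` {n. represents_sps n K}" unfolding sps_def by (rule wellorder_InfI)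
  then obtain n where n: "represents_sps n K" "sps K = enat n" by blast
  then obtain m where m: "superbridge K = enat m" "m \<le> (3 * n - 1) div 2"
    using superbridge_le_represents_sps[OF n(1)] by (cases "superbridge K") auto
  \<comment> \<open>Since \<open>1 \<le> n\<close>, the truncated difference
    \<open>3 * n - 1\<close> is a true one, which turns the halved bound into
    \<open>2 * m \<le> 3 * n - 1\<close>; dividing by 3 gives the claim.\<close>
  have "2 * m + 1 \<le> 3 * n" using m(2) superbridge_le_represents_sps(1)[OF n(1)] by linarith
  then have "2 / 3 * real m + 1 / 3 \<le> real n" by linarith
  then show ?thesis using m n by simp
qed

end
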